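(* Let $Q$ be an interval, $C\ge1$, $\xi^+=\xi^+(C)$, and let $\varphi$ be such that $e^\varphi\in A_\infty^C(Q)$. Then for any $1\le\delta<1/\xi^+$ one has $e^{\delta\varphi}\in A_\infty(Q)$ and $$[e^{\delta\varphi}]_{A_\infty(Q)}\le\frac{e^{-\delta\xi^+}}{1-\delta\xi^+}.$$ This estimate is sharp, i.e., for each $C\ge1$ and each such $\delta$ the right-hand side cannot be replaced by a smaller number depending only on $C$ and $\delta$.
   Context: For an interval $J$, $\langle\varphi\rangle_J=\frac1{|J|}\int_J\varphi$. An a.e. positive function $w$ is in $A_\infty(Q)$ if $w$ and $\log w$ are locally integrable and $[w]_{A_\infty(Q)}:=\sup_{J\subset Q}\langle w\rangle_Je^{-\langle\log w\rangle_J}<\infty$, the supremum being over all subintervals $J$ of the interval $Q$. For $C\ge1$, $A_\infty^C(Q)=\{w\in A_\infty(Q):[w]_{A_\infty(Q)}\le C\}$. For $C\ge1$, $\xi^+=\xi^+(C)$ is the solution of $e^{-\xi}=C(1-\xi)$ with $0\le\xi^+<1$ ($\xi^+=0$ when $C=1$, in which case $1/\xi^+=\infty$). *)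

theory Defs
  imports "HOL-Analysis.Analysis"
begin

definition proper_interval :: "real set \<Rightarrow> bool" where
  "proper_interval Q \<longleftrightarrow> is_interval Q \<and> interior Q \<noteq> {}"

text \<open>Averages are only formed over intervals of positive finite length.\<close>

definition subintervals :: "real set \<Rightarrow> real set set" where
  "subintervals Q = {J. proper_interval J \<and> bounded J \<and> J \<subseteq> Q}"

definition avg :: "real set \<Rightarrow> (real \<Rightarrow> real) \<Rightarrow> real" where
  "avg J f = (LINT x:J|lebesgue. f x) / measure lebesgue J"

text \<open>Local integrability means integrability on every bounded subinterval of \<open>Q\<close>, the form in
  which every average occurring in the supremum below is defined.\<close>

definition locally_integrable :: "real set \<Rightarrow> (real \<Rightarrow> real) \<Rightarrow> bool" where
  "locally_integrable Q f \<longleftrightarrow> (\<forall>J\<in>subintervals Q. set_integrable lebesgue J f)"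

definition Ainf_const :: "real set \<Rightarrow> (real \<Rightarrow> real) \<Rightarrow> ereal" where
  "Ainf_const Q w = (SUP J\<in>subintervals Q. ereal (avg J w * exp (- avg J (\<lambda>x. ln (w x)))))"

definition Ainf :: "real set \<Rightarrow> (real \<Rightarrow> real) set" where
  "Ainf Q = {w. (AE x\<in>Q in lebesgue. 0 < w x) \<and>
     locally_integrable Q w \<and> locally_integrable Q (\<lambda>x. ln (w x)) \<and> Ainf_const Q w < \<infinity>}"

definition Ainf_le :: "real \<Rightarrow> real set \<Rightarrow> (real \<Rightarrow> real) set" where
  "Ainf_le C Q = {w \<in> Ainf Q. Ainf_const Q w \<le> ereal C}"

definition xi_plus :: "real \<Rightarrow> real" where
  "xi_plus C = (THE \<xi>. 0 \<le> \<xi> \<and> \<xi> < 1 \<and> exp (- \<xi>) = C * (1 - \<xi>))"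

lemma xi_plus_ex1:
  assumes "1 \<le> C"
  shows "\<exists>!\<xi>::real. 0 \<le> \<xi> \<and> \<xi> < 1 \<and> exp (- \<xi>) = C * (1 - \<xi>)"
proof (rule ex_ex1I)
  have "\<exists>x\<ge>0. x \<le> 1 \<and> exp (- x) - C * (1 - x) = (0::real)"
    by (rule IVT') (use assms in \<open>auto intro!: continuous_intros\<close>)
  then obtain x :: real where x: "0 \<le> x" "x \<le> 1" "exp (- x) = C * (1 - x)"
    by auto
  have "x \<noteq> 1"
    using x(3) by auto
  with x show "\<exists>\<xi>::real. 0 \<le> \<xi> \<and> \<xi> < 1 \<and> exp (- \<xi>) = C * (1 - \<xi>)"
    by (intro exI[of _ x]) auto
next
  have False if "0 \<le> x" "x < y" "y < 1" "exp (- x) = C * (1 - x)" "exp (- y) = C * (1 - y)"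
    for x y :: real
  proof -
    define t where "t = y - x"
    have t: "t > 0" using that by (simp add: t_def)
    have "exp (- x) * (1 - t) < exp (- x) * exp (- t)"
      using exp_minus_greater[of t] t by simp
    also have "\<dots> = exp (- y)"
      by (simp add: t_def flip: exp_add)
    finally have "C * ((1 - x) * (1 - t)) < C * (1 - y)"
      using that by (simp add: mult.assoc)
    then have "(1 - x) * (1 - t) < 1 - y"
      using assms by simp
    then have "x * t < 0"
      by (simp add: t_def algebra_simps)
    then show False
      using that(1) t by (simp add: mult_less_0_iff)
  qed
  then show "\<xi> = \<eta>" if "0 \<le> \<xi> \<and> \<xi> < 1 \<and> exp (- \<xi>) = C * (1 - \<xi>)"
      "0 \<le> \<eta> \<and> \<eta> < 1 \<and> exp (- \<eta>) = C * (1 - \<eta>)" for \<xi> \<eta> :: real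
    using that by (metis linorder_less_linear)
qed

lemma xi_plus:
  assumes "1 \<le> C"
  shows "0 \<le> xi_plus C" "xi_plus C < 1" "exp (- xi_plus C) = C * (1 - xi_plus C)"
  using theI'[OF xi_plus_ex1[OF assms]] unfolding xi_plus_def by auto

end

theory Submission
  imports Defs
begin

text \<open>Fix an interval with mean \<open>\<mu>\<close> of \<open>\<phi>\<close>. For \<open>\<kappa> \<ge> \<mu> - \<xi>\<close> the rising sun lemma at height
  \<open>\<kappa> + \<xi>\<close> covers \<open>{\<phi> > \<kappa> + \<xi>}\<close>, up to a null set, by disjoint intervals on which \<open>\<phi>\<close> has mean
  exactly \<open>\<kappa> + \<xi>\<close>. The \<open>A\<^sub>\<infinity>\<close> condition on these intervals yields the sharp inequality
  \<open>\<integral> ((1 - \<xi>) * (exp s - 1) - s) \<le> 0\<close> with \<open>s = \<phi> - \<kappa>\<close>, integrated over \<open>{s > 0}\<close>. Integrating it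
  against \<open>exp (\<delta> * \<kappa>)\<close> over \<open>\<kappa> \<ge> \<mu> - \<xi>\<close> and exchanging the integrals bounds the mean of
  \<open>exp (\<delta> * \<phi>)\<close> by \<open>exp (\<delta> * (\<mu> - \<xi>)) / (1 - \<delta> * \<xi>)\<close>. Equality holds for
  \<open>\<phi> x = - \<xi> * ln (x - a)\<close>, where \<open>a\<close> is the left endpoint of \<open>Q\<close>.\<close>

section \<open>Endpoints of bounded intervals and of components of open sets\<close>

lemma bounded_interval_endpoints:
  fixes J :: "real set"
  assumes "is_interval J" "interior J \<noteq> {}" "bounded J"
  obtains a b where "a < b" "{a<..<b} \<subseteq> J" "J \<subseteq> {a..b}"
proof
  have ne: "J \<noteq> {}" and bb: "bdd_below J" and ba: "bdd_above J"
    using assms by (auto intro: bounded_imp_bdd_below bounded_imp_bdd_above)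
  show sub: "J \<subseteq> {Inf J..Sup J}"
    using bb ba by (auto intro: cInf_lower cSup_upper)
  have "interior J \<subseteq> {Inf J<..<Sup J}"
    using interior_mono[OF sub] by (simp add: interior_atLeastAtMost_real)
  then show "Inf J < Sup J"
    using assms(2) by force
  show "{Inf J<..<Sup J} \<subseteq> J"
  proof
    fix x assume "x \<in> {Inf J<..<Sup J}"
    then obtain y z where "y \<in> J" "y < x" "z \<in> J" "x < z"
      using ne bb ba by (metis cInf_less_iff greaterThanLessThan_iff less_cSup_iff)
    then show "x \<in> J"
      using assms(1) by (metis is_interval_1 less_imp_le)
  qed
qed

text \<open>An endpoint of \<open>K\<close> lying in \<open>U\<close> could be joined inside
  \<open>U\<close> to the midpoint of \<open>K\<close>; maximality of the component would then put
  it into the open interval \<open>K\<close>.\<close>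

lemma component_bounded_open:
  fixes U :: "real set"
  assumes "open U" "bounded U" "K \<in> components U"
  obtains a b where "a < b" "K = {a<..<b}" "a \<notin> U" "b \<notin> U"
proof -
  have K: "open K" "connected K" "K \<noteq> {}" "K \<subseteq> U" "bounded K"
    using assms open_components in_components_connected in_components_nonempty
      in_components_subset bounded_subset by metis+
  then have "is_interval K" "interior K \<noteq> {}"
    by (auto simp: is_interval_connected_1 interior_open)
  then obtain a b where ab: "a < b" "{a<..<b} \<subseteq> K" "K \<subseteq> {a..b}"
    using bounded_interval_endpoints K(5) by blast
  have Keq: "K = {a<..<b}"
    using ab(2) interior_mono[OF ab(3)] K(1) by (simp add: interior_open)
  have m: "(a + b) / 2 \<in> K"
    using ab(1) Keq by simp
  have "a \<notin> U"
  proof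
    assume "a \<in> U"
    then have "{a..(a+b)/2} \<subseteq> U"
      using K(4) Keq ab(1) by (force simp: less_le)
    then have "{a..(a+b)/2} \<subseteq> K"
      using components_maximal[OF assms(3), of "{a..(a+b)/2}"] m ab(1) by fastforce
    then have "a \<in> K" using ab(1) by force
    then show False using Keq by simp
  qed
  moreover have "b \<notin> U"
  proof
    assume "b \<in> U"
    then have "{(a+b)/2..b} \<subseteq> U"
      using K(4) Keq ab(1) by (force simp: less_le)
    then have "{(a+b)/2..b} \<subseteq> K"
      using components_maximal[OF assms(3), of "{(a+b)/2..b}"] m ab(1) by fastforce
    then have "b \<in> K" using ab(1) by force
    then show False using Keq by simp
  qed
  ultimately show ?thesis using that ab(1) Keq by blast
qed

section \<open>Rising sun lemma and a sign criterion for integrals\<close>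

text \<open>Finite additivity gives the sign for finite unions; integrability over the whole union
  carries it to the limit along increasing partial unions.\<close>

lemma set_integral_countable_disjoint_nonpos:
  fixes f :: "'a \<Rightarrow> real"
  assumes "countable \<K>" "disjoint \<K>" "\<K> \<subseteq> sets M"
    and int: "set_integrable M (\<Union>\<K>) f"
    and nonpos: "\<And>K. K \<in> \<K> \<Longrightarrow> (LINT x:K|M. f x) \<le> 0"
  shows "(LINT x:\<Union>\<K>|M. f x) \<le> 0"
proof (cases "\<K> = {}")
  case False
  \<comment> \<open>\<open>from_nat_into\<close> repeats elements when \<open>\<K>\<close> is
    finite, so the finite sum below runs over the set of pieces and not over indices.\<close>
  define B where "B n = \<Union>(from_nat_into \<K> ` {..n})" for n
  have sub: "from_nat_into \<K> ` S \<subseteq> \<K>" for S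
    using from_nat_into[OF False] by auto
  have eq: "\<Union>\<K> = (\<Union>n. B n)"
  proof -
    have "range (from_nat_into \<K>) = \<K>"
      using range_from_nat_into[OF False assms(1)] .
    then have "\<Union>\<K> = (\<Union>i. from_nat_into \<K> i)"
      by simp
    also have "\<dots> = (\<Union>n. B n)"
      unfolding B_def by blast
    finally show ?thesis .
  qed
  have B_sets: "B n \<in> sets M" for n
    unfolding B_def using assms(3) from_nat_into[OF False] by (intro sets.finite_Union) auto
  have "(LINT x:B n|M. f x) \<le> 0" for n
  proof -
    let ?F = "from_nat_into \<K> ` {..n}"
    have "(LINT x:\<Union>(id ` ?F)|M. f x) = (\<Sum>K\<in>?F. (LINT x:id K|M. f x))"
    proof (rule set_integral_finite_Union)
      show "disjoint_family_on id ?F"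
        using assms(2) sub[of "{..n}"] unfolding disjoint_family_on_def disjoint_def by auto
      show "id K \<in> sets M" if "K \<in> ?F" for K
        using that sub assms(3) by auto
      then show "set_integrable M (id K) f" if "K \<in> ?F" for K
        using that sub[of "{..n}"] by (intro set_integrable_subset[OF int]) auto
    qed simp
    also have "\<dots> \<le> 0"
      using sub nonpos by (intro sum_nonpos) auto
    finally show ?thesis by (simp add: B_def)
  qed
  moreover have "(\<lambda>n. LINT x:B n|M. f x) \<longlonglongrightarrow> (LINT x:(\<Union>n. B n)|M. f x)"
    by (rule set_integral_cont_up)
      (use B_sets int in \<open>auto simp: eq incseq_def B_def intro: order_trans\<close>)
  ultimately show ?thesis
    unfolding eq by (intro LIMSEQ_le_const2) auto
qed (simp add: set_lebesgue_integral_def)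

text \<open>Let \<open>F\<close> be the primitive of \<open>f\<close> and \<open>U\<close> the set
  of points with a higher value of \<open>F\<close> to their right. \<open>F\<close> takes equal
  values at the two ends of each component of \<open>U\<close>. Outside \<open>U\<close> no later
  value is higher, so the right derivative of \<open>F\<close>, which is \<open>f\<close> almost
  everywhere, is at most 0.\<close>

lemma rising_sun:
  fixes f :: "real \<Rightarrow> real"
  assumes int: "f integrable_on {a..b}"
    and nonpos: "\<And>x. x \<in> {a..b} \<Longrightarrow> integral {a..x} f \<le> 0"
  obtains U N where "open U" "U \<subseteq> {a<..<b}"
    and "\<And>K. K \<in> components U \<Longrightarrow>
      \<exists>c d. a \<le> c \<and> c < d \<and> d \<le> b \<and> K = {c<..<d} \<and> integral {c..d} f = 0"
    and "negligible N" "\<And>x. x \<in> {a..b} - U - N \<Longrightarrow> f x \<le> 0"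
proof -
  define F where "F x = integral {a..x} f" for x
  have contF: "continuous_on {a..b} F"
    unfolding F_def by (rule indefinite_integral_continuous_1[OF int])
  have diff: "integral {c..d} f = F d - F c" if "a \<le> c" "c \<le> d" "d \<le> b" for c d
  proof -
    have "integral {a..c} f + integral {c..d} f = integral {a..d} f"
      by (rule Henstock_Kurzweil_Integration.integral_combine) (use that in \<open>auto intro: integrable_on_subinterval[OF int]\<close>)
    then show ?thesis by (simp add: F_def)
  qed
  define U where "U = {x \<in> {a<..<b}. \<exists>y\<in>{x<..b}. F x < F y}"
  have "open U"
  proof -
    have "U = (\<Union>y\<in>{a..b}. {a<..<y} \<inter> F -` {..<F y})"
      unfolding U_def
      by (auto intro: less_le_trans) (metis atLeastAtMost_iff less_imp_le less_trans)
    moreover have "open ({a<..<y} \<inter> F -` {..<F y})" if "y \<in> {a..b}" for y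
      using that
      by (intro continuous_open_preimage continuous_on_subset[OF contF]) auto
    ultimately show ?thesis by auto
  qed
  have Usub: "U \<subseteq> {a<..<b}" unfolding U_def by auto
  \<comment> \<open>The point \<open>a\<close> is outside \<open>U\<close> by definition, so there
    the claim comes from \<open>nonpos\<close>: \<open>F a = 0\<close> is the maximum of
    \<open>F\<close>.\<close>
  have right_max: "F y \<le> F x" if "x \<in> {a..b} - U" "y \<in> {x..b}" for x y
  proof (cases "x = a \<or> x = b \<or> x = y")
    case True
    then show ?thesis
      using that nonpos[of y] by (auto simp: F_def)
  next
    case False
    then show ?thesis
      using that unfolding U_def by (auto simp: not_less)
  qed
  have comp: "\<exists>c d. a \<le> c \<and> c < d \<and> d \<le> b \<and> K = {c<..<d} \<and> integral {c..d} f = 0"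
    if K: "K \<in> components U" for K
  proof -
    have "bounded U"
      by (rule bounded_subset[OF _ Usub]) simp
    then obtain c d where cd: "c < d" "K = {c<..<d}" "c \<notin> U" "d \<notin> U"
      using component_bounded_open[OF \<open>open U\<close> _ K] by blast
    have KU: "{c<..<d} \<subseteq> U"
      using in_components_subset[OF K] cd by simp
    then have "{c<..<d} \<subseteq> {a<..<b}"
      using Usub by simp
    then have abcd: "a \<le> c" "d \<le> b"
      using cd(1) greaterThanLessThan_subseteq_greaterThanLessThan[of c d a b] by auto
    \<comment> \<open>Take a maximum point \<open>y\<close> of \<open>F\<close> on
      \<open>{x..d}\<close>. If \<open>y < d\<close>, then \<open>y \<in> U\<close> gives a higher
      value further right; it cannot be attained before \<open>d\<close>, and from \<open>d\<close>
      on all values are at most \<open>F d\<close> since \<open>d \<notin> U\<close>.\<close>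
    have up: "F x \<le> F d" if x: "x \<in> {c<..<d}" for x
    proof -
      have "compact {x..d}" "{x..d} \<noteq> {}" "continuous_on {x..d} F"
        using x abcd by (auto intro: continuous_on_subset[OF contF])
      from continuous_attains_sup[OF this] obtain y
        where y: "y \<in> {x..d}" "\<And>z. z \<in> {x..d} \<Longrightarrow> F z \<le> F y"
        by auto
      show ?thesis
      proof (cases "y = d")
        case True
        then show ?thesis using y(2)[of x] x by simp
      next
        case False
        then have "y \<in> U"
          using KU x y(1) by auto
        then obtain z where z: "z \<in> {y<..b}" "F y < F z"
          unfolding U_def by auto
        then have "d \<le> z"
          using y by (metis atLeastAtMost_iff greaterThanAtMost_iff leD less_imp_le
              linorder_not_less order_trans)
        then have "F z \<le> F d"
          using right_max[of d z] z abcd cd by auto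
        then show ?thesis
          using y(2)[of x] x z(2) by auto
      qed
    qed
    \<comment> \<open>Let \<open>x\<close> tend to \<open>c\<close> from the right in
      \<open>up\<close>.\<close>
    have "F c \<le> F d"
    proof (rule tendsto_upperbound)
      have "continuous_on {c..d} F"
        using abcd by (auto intro: continuous_on_subset[OF contF])
      then show "(F \<longlongrightarrow> F c) (at_right c)"
        using cd(1) by (simp add: continuous_on_Icc_at_rightD)
      show "\<forall>\<^sub>F x in at_right c. F x \<le> F d"
        using eventually_at_right_real[OF cd(1)] by eventually_elim (use up in auto)
    qed simp
    moreover have "F d \<le> F c"
      using right_max[of c d] abcd cd by auto
    ultimately have "integral {c..d} f = 0"
      using diff[of c d] abcd cd by simp
    then show ?thesis
      using abcd cd by blast
  qed
  \<comment> \<open>Extension by zero is integrable on every box, as the theorem on almost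
    everywhere differentiation of integrals requires.\<close>
  define g where "g x = (if x \<in> {a..b} then f x else 0)" for x
  have "g integrable_on UNIV"
    unfolding g_def using int by (simp only: integrable_restrict_UNIV)
  then have "g integrable_on cbox c d" for c d
    by (rule integrable_on_subcbox) simp
  from integrable_ccontinuous_explicit[OF this] obtain N where N: "negligible N"
    and lim: "\<And>x e. \<lbrakk>x \<notin> N; 0 < e\<rbrakk> \<Longrightarrow> \<exists>d>0. \<forall>h. 0 < h \<and> h < d \<longrightarrow>
        norm (integral (cbox x (x + h *\<^sub>R One)) g /\<^sub>R h ^ DIM(real) - g x) < e"
    by blast
  \<comment> \<open>At \<open>b\<close> there are no increments to the right within the interval, so
    \<open>b\<close> joins the exceptional set.\<close>
  have "f x \<le> 0" if x: "x \<in> {a..b} - U - insert b N" for x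
  proof (rule ccontr)
    assume "\<not> f x \<le> 0"
    then have pos: "f x > 0" by simp
    have "x \<notin> N" using x by simp
    from lim[OF this pos] obtain d where d: "d > 0"
      and lim': "\<And>h. \<lbrakk>0 < h; h < d\<rbrakk> \<Longrightarrow> norm (integral {x..x+h} g / h - g x) < f x"
      by (auto simp: field_simps)
    define h where "h = min (d/2) (b - x)"
    have h: "0 < h" "h < d" "x + h \<le> b"
      using x d by (auto simp: h_def)
    have "integral {x..x+h} g = integral {x..x+h} f"
      using x h by (intro integral_cong) (auto simp: g_def)
    also have "\<dots> \<le> 0"
      using diff[of x "x+h"] right_max[of x "x+h"] x h by auto
    finally have "integral {x..x+h} g / h \<le> 0"
      using h(1) by (simp add: divide_nonpos_pos)
    moreover have "g x = f x"
      using x by (simp add: g_def)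
    ultimately show False
      using lim'[OF h(1,2)] by (auto simp: abs_if split: if_splits)
  qed
  then show ?thesis
    using that[OF \<open>open U\<close> Usub comp, of "insert b N"] N by auto
qed

text \<open>Split at the last point \<open>c\<close> where the primitive of \<open>f\<close> is
  nonnegative. The interval \<open>{a..c}\<close> is itself balanced. On \<open>{c..b}\<close> the
  rising sun lemma leaves balanced components and a remainder on which \<open>f \<le> 0\<close>,
  hence \<open>g \<le> 0\<close>, almost everywhere.\<close>

lemma rising_sun_integral_nonpos:
  fixes f g :: "real \<Rightarrow> real"
  assumes "a \<le> b" and f: "f integrable_on {a..b}" and f_le: "integral {a..b} f \<le> 0"
    and g: "g absolutely_integrable_on {a..b}"
    and g_nonpos: "\<And>x. f x \<le> 0 \<Longrightarrow> g x \<le> 0"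
    and balanced: "\<And>c d. \<lbrakk>a \<le> c; c < d; d \<le> b; integral {c..d} f = 0\<rbrakk> \<Longrightarrow> integral {c..d} g \<le> 0"
  shows "integral {a..b} g \<le> 0"
proof -
  define F where "F x = integral {a..x} f" for x
  have contF: "continuous_on {a..b} F"
    unfolding F_def by (rule indefinite_integral_continuous_1[OF f])
  have "compact ({a..b} \<inter> F -` {0..})"
    using continuous_closed_preimage[OF contF, of "{0..}"]
    by (simp add: compact_eq_bounded_closed bounded_Int)
  moreover have "a \<in> {a..b} \<inter> F -` {0..}"
    using \<open>a \<le> b\<close> by (simp add: F_def)
  then have "{a..b} \<inter> F -` {0..} \<noteq> {}"
    by blast
  ultimately obtain c where "c \<in> {a..b} \<inter> F -` {0..}" "\<forall>x\<in>{a..b} \<inter> F -` {0..}. x \<le> c"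
    using compact_attains_sup by metis
  then have c: "c \<in> {a..b}" "F c \<ge> 0" "\<And>x. \<lbrakk>x \<in> {a..b}; F x \<ge> 0\<rbrakk> \<Longrightarrow> x \<le> c"
    by auto
  \<comment> \<open>\<open>F\<close> passes from \<open>F c \<ge> 0\<close> to
    \<open>F b \<le> 0\<close>, so it vanishes somewhere in \<open>{c..b}\<close>; by the choice of
    \<open>c\<close> this can only be at \<open>c\<close>.\<close>
  have Fc: "F c = 0"
  proof -
    have "continuous_on {c..b} F"
      using c(1) by (auto intro: continuous_on_subset[OF contF])
    then obtain x where x: "c \<le> x" "x \<le> b" "F x = 0"
      using IVT2'[of F b 0 c] c(1,2) f_le by (auto simp: F_def)
    then have "x = c"
      using c(1) c(3)[of x] by auto
    then show ?thesis using x by simp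
  qed
  have comb: "integral {a..c} h + integral {c..x} h = integral {a..x} h"
    if "h integrable_on {a..b}" "x \<in> {c..b}" for h :: "real \<Rightarrow> real" and x
    by (rule Henstock_Kurzweil_Integration.integral_combine)
      (use that c(1) in \<open>auto intro: integrable_on_subinterval\<close>)
  have g_int: "g integrable_on {a..b}"
    using g set_lebesgue_integral_eq_integral by blast
  have "integral {a..c} g \<le> 0"
    using balanced[of a c] c(1) Fc by (cases "a = c") (auto simp: F_def)
  moreover have "integral {c..b} g \<le> 0"
  proof -
    \<comment> \<open>\<open>F c = 0\<close> and \<open>F\<close> is negative beyond
      \<open>c\<close>, which is what \<open>rising_sun\<close> asks for on
      \<open>{c..b}\<close>.\<close>
    have "integral {c..x} f \<le> 0" if "x \<in> {c..b}" for x
      using comb[OF f that] c(3)[of x] Fc that c(1) by (fastforce simp: F_def)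
    moreover have "f integrable_on {c..b}"
      using c(1) by (auto intro: integrable_on_subinterval[OF f])
    ultimately obtain U N where U: "open U" "U \<subseteq> {c<..<b}"
      and comp: "\<And>K. K \<in> components U \<Longrightarrow>
        \<exists>p q. c \<le> p \<and> p < q \<and> q \<le> b \<and> K = {p<..<q} \<and> integral {p..q} f = 0"
      and N: "negligible N" "\<And>x. x \<in> {c..b} - U - N \<Longrightarrow> f x \<le> 0"
      using rising_sun[of f c b] by metis
    have sets: "U \<in> sets lebesgue" "{c..b} - U \<in> sets lebesgue"
      using U(1) by auto
    have "U \<subseteq> {a..b}"
      using U(2) c(1) by auto
    then have gU: "set_integrable lebesgue U g"
      using set_integrable_subset[OF g] sets by blast
    have gP: "set_integrable lebesgue ({c..b} - U) g"
      using set_integrable_subset[OF g] sets c(1) by force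
    have "(LINT x:\<Union>(components U)|lebesgue. g x) \<le> 0"
    proof (rule set_integral_countable_disjoint_nonpos)
      show disj: "disjoint (components U)"
        using components_nonoverlap by (auto simp: disjoint_def)
      show "countable (components U)"
        by (rule countable_disjoint_open_subsets[OF open_components[OF U(1)] disj])
      show "components U \<subseteq> sets lebesgue"
        using open_components[OF U(1)] by auto
      show "set_integrable lebesgue (\<Union>(components U)) g"
        using gU by (simp add: Union_components)
      show "(LINT x:K|lebesgue. g x) \<le> 0" if K: "K \<in> components U" for K
      proof -
        from comp[OF K] obtain p q where
          pq: "c \<le> p" "p < q" "q \<le> b" "K = {p<..<q}" "integral {p..q} f = 0"
          by blast
        have "set_integrable lebesgue K g"
          using in_components_subset[OF K] pq(4) by (intro set_integrable_subset[OF gU]) auto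
        then have "(LINT x:K|lebesgue. g x) = integral {p..q} g"
          using pq(4) by (simp add: set_lebesgue_integral_eq_integral integral_open_interval_real)
        also have "\<dots> \<le> 0"
          using balanced pq c(1) by auto
        finally show ?thesis .
      qed
    qed
    then have "(LINT x:U|lebesgue. g x) \<le> 0"
      by (simp add: Union_components)
    moreover have "(LINT x:{c..b} - U|lebesgue. g x) \<le> (LINT x:{c..b} - U|lebesgue. 0)"
    proof (rule set_integral_mono_AE[OF gP])
      have "AE x in lebesgue. x \<notin> N"
        using N(1) by (simp add: AE_not_in negligible_iff_null_sets)
      then show "AE x\<in>{c..b} - U in lebesgue. g x \<le> 0"
        by eventually_elim (use N(2) g_nonpos in auto)
    qed (simp add: set_integrable_def)
    ultimately have "(LINT x:U \<union> ({c..b} - U)|lebesgue. g x) \<le> 0"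
      using set_integral_Un[OF _ gU gP] by (simp add: set_lebesgue_integral_def)
    moreover have "U \<union> ({c..b} - U) = {c..b}"
      using U(2) by auto
    moreover have "set_integrable lebesgue {c..b} g"
      using c(1) by (intro set_integrable_subset[OF g]) auto
    ultimately show ?thesis
      by (simp add: set_lebesgue_integral_eq_integral)
  qed
  ultimately show ?thesis
    using comb[OF g_int, of b] c(1) by auto
qed

section \<open>The function \<open>excess\<close> and the sign of its integral\<close>

text \<open>For \<open>s > 0\<close> and \<open>exp (- \<xi>) = C * (1 - \<xi>)\<close> this is \<open>(exp (s - \<xi>) - C * (1 + s - \<xi>)) / C\<close>,
  whose convex numerator vanishes at \<open>s = 0\<close>. On an interval with mean \<open>s\<close> equal to \<open>\<xi>\<close> the
  \<open>A\<^sub>\<infinity>\<close> condition makes the integral of the numerator nonpositive; cutting it off below \<open>s = 0\<close>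
  decreases it further and keeps it nonpositive for \<open>s \<le> \<xi>\<close>.\<close>

definition excess :: "real \<Rightarrow> real \<Rightarrow> real" where
  "excess \<xi> s = (1 - \<xi>) * (exp (max 0 s) - 1) - max 0 s"

lemma excess_eq_0: "s \<le> 0 \<Longrightarrow> excess \<xi> s = 0"
  by (simp add: excess_def)

text \<open>For \<open>s \<le> 0\<close> the right-hand side is
  \<open>(exp s - 1 - s) + \<xi> * (1 - exp s)\<close>, a sum of nonnegative terms; for
  \<open>s > 0\<close> the cutoff is inactive.\<close>

lemma excess_le:
  assumes "0 \<le> \<xi>"
  shows "excess \<xi> s \<le> (1 - \<xi>) * (exp s - 1) - s"
proof (cases "s \<le> 0")
  case True
  have "\<xi> * (exp s - 1) \<le> 0"
    using True assms by (simp add: mult_nonneg_nonpos)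
  moreover have "s \<le> exp s - 1"
    using exp_ge_add_one_self[of s] by linarith
  moreover have "excess \<xi> s = 0"
    using True by (simp add: excess_def)
  moreover have "(1 - \<xi>) * (exp s - 1) = (exp s - 1) - \<xi> * (exp s - 1)"
    by (simp add: algebra_simps)
  ultimately show ?thesis
    by linarith
qed (simp add: excess_def)

text \<open>For \<open>0 < s \<le> \<xi>\<close>, replacing \<open>1 - \<xi>\<close> by the larger
  \<open>1 - s\<close> gives the bound \<open>(1 - s) * exp s - 1\<close>, which is nonpositive
  because \<open>1 - s \<le> exp (- s)\<close>.\<close>

lemma excess_nonpos:
  assumes "s \<le> \<xi>"
  shows "excess \<xi> s \<le> 0"
proof (cases "s \<le> 0")
  case False
  have "(1 - \<xi>) * (exp s - 1) \<le> (1 - s) * (exp s - 1)"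
    using False assms by (intro mult_right_mono) auto
  moreover have "(1 - s) * exp s \<le> exp (- s) * exp s"
    using exp_ge_add_one_self[of "- s"] by (intro mult_right_mono) auto
  moreover have "exp (- s) * exp s = 1"
    by (simp flip: exp_add)
  ultimately show ?thesis
    using False by (simp add: excess_def algebra_simps)
qed (simp add: excess_def)

lemma absolutely_integrable_excess:
  fixes \<phi> :: "real \<Rightarrow> real"
  assumes "\<phi> absolutely_integrable_on {a..b}" "(\<lambda>x. exp (\<phi> x)) absolutely_integrable_on {a..b}"
  shows "(\<lambda>x. excess \<xi> (\<phi> x - \<kappa>)) absolutely_integrable_on {a..b}"
proof -
  have const: "(\<lambda>x. c) absolutely_integrable_on {a..b}" for c :: real
    by (simp add: absolutely_integrable_continuous_real)
  \<comment> \<open>The cutoff commutes with \<open>exp\<close>, turning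
    \<open>exp (max 0 s)\<close> into \<open>max 1 (exp s)\<close>; only operations preserving
    absolute integrability remain.\<close>
  have "(\<lambda>x. (1 - \<xi>) * (max 1 (exp (\<phi> x) * exp (- \<kappa>)) - 1) - max 0 (\<phi> x - \<kappa>))
    absolutely_integrable_on {a..b}"
    using assms const
    by (intro set_integral_diff set_integrable_mult_right absolutely_integrable_max_1
        set_integrable_mult_left) auto
  moreover have "excess \<xi> (\<phi> x - \<kappa>)
      = (1 - \<xi>) * (max 1 (exp (\<phi> x) * exp (- \<kappa>)) - 1) - max 0 (\<phi> x - \<kappa>)" for x
  proof -
    have "exp (max 0 (\<phi> x - \<kappa>)) = max 1 (exp (\<phi> x - \<kappa>))"
      by (simp add: max_def)
    then show ?thesis
      by (simp add: excess_def exp_diff exp_minus field_simps)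
  qed
  ultimately show ?thesis by simp
qed

text \<open>The sign criterion is applied with \<open>f\<close> equal to \<open>\<phi>\<close> minus
  the height \<open>\<kappa> + \<xi>\<close>. Below that height \<open>excess\<close> is nonpositive
  pointwise; on balanced intervals \<open>\<phi>\<close> has mean \<open>\<kappa> + \<xi>\<close>
  and hypothesis \<open>A\<close> takes over.\<close>

lemma integral_excess_nonpos:
  fixes \<phi> :: "real \<Rightarrow> real"
  assumes "a < b" "0 \<le> \<xi>" "\<xi> < 1" and C: "exp (- \<xi>) = C * (1 - \<xi>)"
    and \<phi>: "\<phi> absolutely_integrable_on {a..b}"
    and e\<phi>: "(\<lambda>x. exp (\<phi> x)) absolutely_integrable_on {a..b}"
    and A: "\<And>c d. \<lbrakk>a \<le> c; c < d; d \<le> b\<rbrakk> \<Longrightarrow>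
      integral {c..d} (\<lambda>x. exp (\<phi> x)) \<le> (d - c) * C * exp (integral {c..d} \<phi> / (d - c))"
    and \<kappa>: "integral {a..b} \<phi> \<le> (\<kappa> + \<xi>) * (b - a)"
  shows "integral {a..b} (\<lambda>x. excess \<xi> (\<phi> x - \<kappa>)) \<le> 0"
proof (rule rising_sun_integral_nonpos[where f = "\<lambda>x. \<phi> x - (\<kappa> + \<xi>)"])
  have ints: "\<phi> integrable_on {c..d}" "(\<lambda>x. exp (\<phi> x)) integrable_on {c..d}"
    "(\<lambda>x. excess \<xi> (\<phi> x - \<kappa>)) integrable_on {c..d}" if "a \<le> c" "d \<le> b" for c d
    using that \<phi> e\<phi> absolutely_integrable_excess[OF \<phi> e\<phi>]
    by (auto intro!: integrable_on_subinterval[OF set_lebesgue_integral_eq_integral(1)])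
  have shift: "integral {c..d} (\<lambda>x. \<phi> x - m) = integral {c..d} \<phi> - m * (d - c)"
    if "a \<le> c" "c \<le> d" "d \<le> b" for c d m
    using has_integral_diff[OF integrable_integral[OF ints(1)] has_integral_const_real[of m c d]] that
    by (simp add: integral_unique mult.commute)
  show "(\<lambda>x. \<phi> x - (\<kappa> + \<xi>)) integrable_on {a..b}"
    using ints(1)[of a b] by (intro integrable_diff) auto
  show "integral {a..b} (\<lambda>x. \<phi> x - (\<kappa> + \<xi>)) \<le> 0"
    using \<kappa> \<open>a < b\<close> by (simp add: shift)
  show "(\<lambda>x. excess \<xi> (\<phi> x - \<kappa>)) absolutely_integrable_on {a..b}"
    by (rule absolutely_integrable_excess[OF \<phi> e\<phi>])
  show "excess \<xi> (\<phi> x - \<kappa>) \<le> 0" if "\<phi> x - (\<kappa> + \<xi>) \<le> 0" for x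
    using that by (intro excess_nonpos) simp
  show "integral {c..d} (\<lambda>x. excess \<xi> (\<phi> x - \<kappa>)) \<le> 0"
    if cd: "a \<le> c" "c < d" "d \<le> b" and bal: "integral {c..d} (\<lambda>x. \<phi> x - (\<kappa> + \<xi>)) = 0" for c d
  proof -
    note int = ints[OF cd(1,3)]
    have mean: "integral {c..d} \<phi> = (\<kappa> + \<xi>) * (d - c)"
      using bal cd by (simp add: shift)
    have "exp (- \<kappa>) * integral {c..d} (\<lambda>x. exp (\<phi> x)) \<le> exp (- \<kappa>) * ((d - c) * C * exp (\<kappa> + \<xi>))"
      using A[OF cd] cd(2) mean by (intro mult_left_mono) auto
    also have "\<dots> = (d - c) * (C * exp \<xi>)"
      by (simp add: exp_add exp_minus)
    \<comment> \<open>The factor \<open>1 - \<xi>\<close> absorbs the constant, since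
      \<open>C * (1 - \<xi>) * exp \<xi> = 1\<close>.\<close>
    finally have "(1 - \<xi>) * (exp (- \<kappa>) * integral {c..d} (\<lambda>x. exp (\<phi> x)))
        \<le> (1 - \<xi>) * ((d - c) * (C * exp \<xi>))"
      using \<open>\<xi> < 1\<close> by (intro mult_left_mono) auto
    also have "\<dots> = (d - c) * (exp (- \<xi>) * exp \<xi>)"
      unfolding C by (simp add: algebra_simps)
    also have "\<dots> = d - c"
      by (simp add: exp_minus)
    finally have mass: "(1 - \<xi>) * (exp (- \<kappa>) * integral {c..d} (\<lambda>x. exp (\<phi> x))) \<le> d - c" .
    have "((\<lambda>x. (1 - \<xi>) * (exp (- \<kappa>) * exp (\<phi> x) - 1) - (\<phi> x - \<kappa>)) has_integral
        (1 - \<xi>) * (exp (- \<kappa>) * integral {c..d} (\<lambda>x. exp (\<phi> x)) - (d - c))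
          - (integral {c..d} \<phi> - (d - c) * \<kappa>)) {c..d}"
      using int(1,2) cd(2) has_integral_const_real[of "1::real" c d] has_integral_const_real[of \<kappa> c d]
      by (intro has_integral_diff has_integral_mult_right integrable_integral) auto
    moreover have "excess \<xi> (\<phi> x - \<kappa>) \<le> (1 - \<xi>) * (exp (- \<kappa>) * exp (\<phi> x) - 1) - (\<phi> x - \<kappa>)" for x
      using excess_le[OF \<open>0 \<le> \<xi>\<close>, of "\<phi> x - \<kappa>"] by (simp add: exp_diff exp_minus field_simps)
    ultimately have "integral {c..d} (\<lambda>x. excess \<xi> (\<phi> x - \<kappa>))
      \<le> (1 - \<xi>) * (exp (- \<kappa>) * integral {c..d} (\<lambda>x. exp (\<phi> x)) - (d - c))
          - (integral {c..d} \<phi> - (d - c) * \<kappa>)"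
      using int(3) by (intro has_integral_le[OF integrable_integral]) auto
    \<comment> \<open>By \<open>mass\<close> and \<open>mean\<close> the sum is at most
      \<open>(d - c) * (1 - (1 - \<xi>) - \<xi>) = 0\<close>.\<close>
    also have "\<dots> \<le> 0"
      using mass unfolding mean by (simp add: algebra_simps)
    finally show ?thesis .
  qed
qed (use \<open>a < b\<close> in auto)

section \<open>Pointwise bound for the truncated exponential\<close>

lemma exp_convex_combination:
  fixes x y t :: real
  assumes "0 \<le> t" "t \<le> 1"
  shows "exp (t * x + (1 - t) * y) \<le> t * exp x + (1 - t) * exp y"
  using convex_onD[OF exp_convex, of "1 - t" x y] assms by simp

text \<open>Bernoulli's inequality with base \<open>exp p\<close> and real exponent
  \<open>\<delta>\<close>, from convexity at
  \<open>p = 1 / \<delta> * (\<delta> * p) + (1 - 1 / \<delta>) * 0\<close>.\<close>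

lemma bernoulli_exp:
  fixes p \<delta> :: real
  assumes "1 \<le> \<delta>"
  shows "1 + \<delta> * (exp p - 1) \<le> exp (\<delta> * p)"
proof -
  have "exp p \<le> 1 / \<delta> * exp (\<delta> * p) + (1 - 1 / \<delta>)"
    using exp_convex_combination[of "1 / \<delta>" "\<delta> * p" 0] assms by simp
  then have "\<delta> * exp p \<le> \<delta> * (1 / \<delta> * exp (\<delta> * p) + (1 - 1 / \<delta>))"
    using assms by (intro mult_left_mono) auto
  also have "\<dots> = exp (\<delta> * p) + (\<delta> - 1)"
    using assms by (simp add: algebra_simps)
  finally show ?thesis
    by (simp add: algebra_simps)
qed

text \<open>The case of \<open>truncated_exp_bound\<close> in which the integral of
  \<open>excess\<close> vanishes. Both sides agree at \<open>p = 0\<close>, and their difference is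
  nonincreasing for \<open>p \<le> 0\<close>.\<close>

lemma truncated_exp_bound_nonpos:
  fixes p \<delta> \<xi> :: real
  assumes "1 < \<delta>" "0 \<le> \<xi>" "\<delta> * \<xi> < 1" "p \<le> 0"
  shows "(1 - \<delta> * \<xi>) * exp (\<delta> * p)
    \<le> (1 - \<xi>) * \<delta>\<^sup>2 * exp p - (\<delta> - 1) * (\<delta> * (1 - \<xi>) + 1) - \<delta> * (\<delta> - 1) * p"
proof -
  define D where "D p = (1 - \<xi>) * \<delta>\<^sup>2 * exp p - \<delta> * (\<delta> - 1) * p - (1 - \<delta> * \<xi>) * exp (\<delta> * p)" for p
  have "D 0 \<le> D p"
  proof (rule DERIV_nonpos_imp_nonincreasing[OF \<open>p \<le> 0\<close>])
    fix x :: real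
    assume x: "p \<le> x" "x \<le> 0"
    define D' where "D' = (1 - \<xi>) * \<delta>\<^sup>2 * exp x - \<delta> * (\<delta> - 1) - (1 - \<delta> * \<xi>) * (exp (\<delta> * x) * \<delta>)"
    have "(D has_real_derivative D') (at x)"
      unfolding D_def D'_def by (auto intro!: derivative_eq_intros)
    moreover have "D' \<le> 0"
    proof -
      \<comment> \<open>Bernoulli's inequality bounds \<open>D' / \<delta>\<close> by
        \<open>\<delta> * \<xi> * (\<delta> - 1) * (exp x - 1)\<close>.\<close>
      have "(1 - \<delta> * \<xi>) * (1 + \<delta> * (exp x - 1)) \<le> (1 - \<delta> * \<xi>) * exp (\<delta> * x)"
        using bernoulli_exp[of \<delta> x] assms by (intro mult_left_mono) auto
      moreover have "\<delta> * \<xi> * (\<delta> - 1) * (exp x - 1) \<le> 0"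
        using assms x by (intro mult_nonneg_nonpos) auto
      ultimately have "(1 - \<xi>) * \<delta> * exp x - (\<delta> - 1) - (1 - \<delta> * \<xi>) * exp (\<delta> * x) \<le> 0"
        by (simp add: algebra_simps)
      then have "\<delta> * ((1 - \<xi>) * \<delta> * exp x - (\<delta> - 1) - (1 - \<delta> * \<xi>) * exp (\<delta> * x)) \<le> 0"
        using assms by (intro mult_nonneg_nonpos) auto
      then show ?thesis
        by (simp add: D'_def algebra_simps power2_eq_square)
    qed
    ultimately show "\<exists>y. (D has_real_derivative y) (at x) \<and> y \<le> 0"
      by blast
  qed
  then show ?thesis
    by (simp add: D_def algebra_simps power2_eq_square)
qed

lemma continuous_on_excess [continuous_intros]:
  "continuous_on S f \<Longrightarrow> continuous_on S (\<lambda>x. excess \<xi> (f x))"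
  unfolding excess_def by (intro continuous_intros)

text \<open>For \<open>k \<le> p\<close> the cutoff is inactive, and \<open>A\<close> is an
  antiderivative of the integrand; the term with \<open>p - k\<close> is integrated by
  parts.\<close>

lemma integral_exp_excess:
  fixes p \<delta> \<xi> :: real
  assumes "1 < \<delta>" "0 \<le> m" "m \<le> p"
  defines "A \<equiv> \<lambda>k. (1 - \<xi>) * (exp (p + (\<delta> - 1) * k) / (\<delta> - 1) - exp (\<delta> * k) / \<delta>)
      - ((p - k) * exp (\<delta> * k) / \<delta> + exp (\<delta> * k) / \<delta>\<^sup>2)"
  shows "integral {0..m} (\<lambda>k. exp (\<delta> * k) * excess \<xi> (p - k)) = A m - A 0"
proof (rule integral_unique)
  show "((\<lambda>k. exp (\<delta> * k) * excess \<xi> (p - k)) has_integral A m - A 0) {0..m}"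
  proof (rule fundamental_theorem_of_calculus[OF \<open>0 \<le> m\<close>])
    fix k assume k: "k \<in> {0..m}"
    \<comment> \<open>Naming the reciprocals keeps the derivative polynomial; \<open>uv\<close>
      removes them at the end.\<close>
    define u v where "u = 1 / (\<delta> - 1)" and "v = 1 / \<delta>"
    have uv: "u * (\<delta> - 1) = 1" "v * \<delta> = 1"
      using assms(1) by (auto simp: u_def v_def)
    have A: "A = (\<lambda>k. (1 - \<xi>) * (u * exp (p + (\<delta> - 1) * k) - v * exp (\<delta> * k))
        - (v * ((p - k) * exp (\<delta> * k)) + v * v * exp (\<delta> * k)))"
      by (simp add: A_def u_def v_def power2_eq_square)
    have "(A has_real_derivative
        (1 - \<xi>) * (u * (exp (p + (\<delta> - 1) * k) * (\<delta> - 1)) - v * (exp (\<delta> * k) * \<delta>))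
          - (v * ((p - k) * (exp (\<delta> * k) * \<delta>) - exp (\<delta> * k)) + v * v * (exp (\<delta> * k) * \<delta>))) (at k)"
      unfolding A by (auto intro!: derivative_eq_intros simp: algebra_simps)
    also have "(1 - \<xi>) * (u * (exp (p + (\<delta> - 1) * k) * (\<delta> - 1)) - v * (exp (\<delta> * k) * \<delta>))
          - (v * ((p - k) * (exp (\<delta> * k) * \<delta>) - exp (\<delta> * k)) + v * v * (exp (\<delta> * k) * \<delta>))
        = (1 - \<xi>) * ((u * (\<delta> - 1)) * exp (p + (\<delta> - 1) * k) - (v * \<delta>) * exp (\<delta> * k))
          - ((v * \<delta>) * ((p - k) * exp (\<delta> * k)) - v * exp (\<delta> * k) + v * (v * \<delta>) * exp (\<delta> * k))"
      by (simp add: algebra_simps)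
    finally have "(A has_real_derivative
        (1 - \<xi>) * (exp (p + (\<delta> - 1) * k) - exp (\<delta> * k)) - (p - k) * exp (\<delta> * k)) (at k)"
      unfolding uv by simp
    moreover have "exp (p + (\<delta> - 1) * k) = exp (\<delta> * k) * exp (p - k)"
      by (simp flip: exp_add add: algebra_simps)
    ultimately show "(A has_vector_derivative exp (\<delta> * k) * excess \<xi> (p - k)) (at k within {0..m})"
      using k assms(3)
      by (auto simp: excess_def max_def algebra_simps has_real_derivative_iff_has_vector_derivative
          intro: has_vector_derivative_at_within)
  qed
qed

text \<open>The weighted integral of \<open>excess\<close> reproduces \<open>exp (\<delta> * p)\<close> with the positive factor
  \<open>1 - \<delta> * \<xi>\<close>, up to terms in \<open>exp p\<close> and \<open>p\<close> whose averages are controlled. Truncating at \<open>N\<close>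
  avoids assuming that \<open>exp (\<delta> * p)\<close> is integrable.\<close>

lemma truncated_exp_bound:
  fixes p \<delta> \<xi> :: real
  assumes "1 < \<delta>" "0 \<le> \<xi>" "\<delta> * \<xi> < 1" "0 \<le> N"
  shows "(1 - \<delta> * \<xi>) * exp (\<delta> * min p N)
    \<le> (1 - \<xi>) * \<delta>\<^sup>2 * exp p - (\<delta> - 1) * (\<delta> * (1 - \<xi>) + 1) - \<delta> * (\<delta> - 1) * p
      + \<delta>\<^sup>2 * (\<delta> - 1) * integral {0..N} (\<lambda>k. exp (\<delta> * k) * excess \<xi> (p - k))"
proof (cases "p \<le> 0")
  case True
  have "integral {0..N} (\<lambda>k. exp (\<delta> * k) * excess \<xi> (p - k)) = integral {0..N} (\<lambda>k. 0)"
    using True by (intro integral_cong) (auto simp: excess_eq_0)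
  then show ?thesis
    using True \<open>0 \<le> N\<close> truncated_exp_bound_nonpos[OF assms(1-3) True] by simp
next
  case False
  \<comment> \<open>The integrand vanishes for \<open>k \<ge> p\<close>, so the integral over
    \<open>{0..N}\<close> stops at \<open>m\<close>; \<open>q\<close> is the part of
    \<open>p\<close> above the truncation level.\<close>
  define m where "m = min p N"
  define q where "q = p - m"
  have m: "0 \<le> m" "m \<le> p" "m \<le> N" and "0 \<le> q"
    using False \<open>0 \<le> N\<close> by (auto simp: m_def q_def)
  have "integral {0..m} (\<lambda>k. exp (\<delta> * k) * excess \<xi> (p - k))
      + integral {m..N} (\<lambda>k. exp (\<delta> * k) * excess \<xi> (p - k))
    = integral {0..N} (\<lambda>k. exp (\<delta> * k) * excess \<xi> (p - k))"
    using m by (intro Henstock_Kurzweil_Integration.integral_combine integrable_continuous_real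
        continuous_intros)
  moreover have "integral {m..N} (\<lambda>k. exp (\<delta> * k) * excess \<xi> (p - k)) = 0"
  proof (cases "p \<le> N")
    case True
    then have "integral {m..N} (\<lambda>k. exp (\<delta> * k) * excess \<xi> (p - k)) = integral {m..N} (\<lambda>k. 0)"
      by (intro integral_cong) (auto simp: excess_eq_0 m_def)
    then show ?thesis by simp
  qed (simp add: m_def)
  ultimately have int: "integral {0..N} (\<lambda>k. exp (\<delta> * k) * excess \<xi> (p - k)) =
      (1 - \<xi>) * (exp (p + (\<delta> - 1) * m) / (\<delta> - 1) - exp (\<delta> * m) / \<delta>)
      - ((p - m) * exp (\<delta> * m) / \<delta> + exp (\<delta> * m) / \<delta>\<^sup>2)
      - ((1 - \<xi>) * (exp p / (\<delta> - 1) - 1 / \<delta>) - (p / \<delta> + 1 / \<delta>\<^sup>2))"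
    using integral_exp_excess[OF assms(1) m(1,2), of \<xi>] by simp
  have split: "exp (p + (\<delta> - 1) * m) = exp (\<delta> * m) * exp q"
    by (simp add: q_def flip: exp_add add: algebra_simps)
  \<comment> \<open>The contribution of \<open>k = 0\<close> cancels the explicit terms in
    \<open>exp p\<close>, in \<open>p\<close> and the constant, leaving only that of
    \<open>k = m\<close>.\<close>
  have eq: "(1 - \<xi>) * \<delta>\<^sup>2 * exp p - (\<delta> - 1) * (\<delta> * (1 - \<xi>) + 1) - \<delta> * (\<delta> - 1) * p
      + \<delta>\<^sup>2 * (\<delta> - 1) * integral {0..N} (\<lambda>k. exp (\<delta> * k) * excess \<xi> (p - k))
    = exp (\<delta> * m) * ((1 - \<xi>) * \<delta>\<^sup>2 * exp q - (1 - \<xi>) * \<delta> * (\<delta> - 1) - \<delta> * (\<delta> - 1) * q - (\<delta> - 1))"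
  proof -
    have clear: "\<delta>\<^sup>2 * D * ((1 - \<xi>) * (X / D - E / \<delta>) - (q * E / \<delta> + E / \<delta>\<^sup>2)
          - ((1 - \<xi>) * (P / D - 1 / \<delta>) - (p / \<delta> + 1 / \<delta>\<^sup>2)))
        = (1 - \<xi>) * (\<delta>\<^sup>2 * X - \<delta> * D * E) - (\<delta> * D * q * E + D * E)
          - ((1 - \<xi>) * (\<delta>\<^sup>2 * P - \<delta> * D) - (\<delta> * D * p + D))" if "D \<noteq> 0" for D E P X
      using that assms(1) by (simp add: field_simps power2_eq_square)
    have pm: "p - m = q" and ne: "\<delta> - 1 \<noteq> 0"
      using assms(1) by (auto simp: q_def)
    show ?thesis
      unfolding int split pm clear[OF ne] by (simp add: algebra_simps)
  qed
  have "\<xi> \<le> \<delta> * \<xi>"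
    using mult_right_mono[of 1 \<delta> \<xi>] assms by simp
  \<comment> \<open>With \<open>exp q\<close> replaced by \<open>1 + q\<close>, the bracket in
    \<open>eq\<close> becomes \<open>(1 - \<delta> * \<xi>) * (1 + \<delta> * q)\<close>.\<close>
  then have "(1 - \<xi>) * \<delta>\<^sup>2 * (1 + q) \<le> (1 - \<xi>) * \<delta>\<^sup>2 * exp q"
    using assms exp_ge_add_one_self[of q] by (intro mult_left_mono) auto
  moreover have "0 \<le> \<delta> * q * (1 - \<delta> * \<xi>)"
    using assms \<open>0 \<le> q\<close> by simp
  ultimately have "1 - \<delta> * \<xi>
      \<le> (1 - \<xi>) * \<delta>\<^sup>2 * exp q - (1 - \<xi>) * \<delta> * (\<delta> - 1) - \<delta> * (\<delta> - 1) * q - (\<delta> - 1)"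
    by (simp add: algebra_simps power2_eq_square)
  then have "exp (\<delta> * m) * (1 - \<delta> * \<xi>) \<le> exp (\<delta> * m) *
      ((1 - \<xi>) * \<delta>\<^sup>2 * exp q - (1 - \<xi>) * \<delta> * (\<delta> - 1) - \<delta> * (\<delta> - 1) * q - (\<delta> - 1))"
    by (intro mult_left_mono) auto
  then show ?thesis
    unfolding eq by (simp add: m_def mult.commute)
qed

section \<open>Integral bound for the scaled exponential\<close>

text \<open>Fubini's theorem on \<open>{a..b}\<close> times \<open>{0..N}\<close>: with
  \<open>x\<close> integrated first, each slice is nonpositive by \<open>nonpos\<close>.\<close>

lemma integral_weighted_excess_nonpos:
  fixes p :: "real \<Rightarrow> real"
  assumes p: "p absolutely_integrable_on {a..b}"
    and ep: "(\<lambda>x. exp (p x)) absolutely_integrable_on {a..b}"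
    and \<xi>: "0 \<le> \<xi>" "\<xi> < 1" and "0 \<le> \<delta>" "0 \<le> N"
    and nonpos: "\<And>k. k \<in> {0..N} \<Longrightarrow> integral {a..b} (\<lambda>x. excess \<xi> (p x - k)) \<le> 0"
  defines "H \<equiv> \<lambda>x. integral {0..N} (\<lambda>k. exp (\<delta> * k) * excess \<xi> (p x - k))"
  shows "H integrable_on {a..b}" "integral {a..b} H \<le> 0"
proof -
  define M1 where "M1 = lebesgue_on {a..b}"
  define M2 where "M2 = lebesgue_on {0..N}"
  define f where "f x k = exp (\<delta> * k) * excess \<xi> (p x - k)" for x k
  \<comment> \<open>A majorant of the integrand that does not depend on \<open>k\<close>:
    \<open>excess\<close> is controlled by \<open>exp (max 0 (p x - k))\<close> and
    \<open>max 0 (p x - k)\<close>, which are largest at \<open>k = 0\<close>.\<close>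
  define w where "w x = exp (\<delta> * N) * (max 1 (exp (p x)) + max 0 (p x))" for x
  have conv: "integrable (lebesgue_on {c..d}) h \<longleftrightarrow> h absolutely_integrable_on {c..d}"
    for h :: "real \<Rightarrow> real" and c d
    by (simp add: integrable_restrict_space set_integrable_def)
  have L: "integral\<^sup>L (lebesgue_on {c..d}) h = integral {c..d} h"
    if "h absolutely_integrable_on {c..d}" for h :: "real \<Rightarrow> real" and c d
    using that by (simp add: lebesgue_integral_eq_integral conv)
  have fin: "finite_measure M1" "finite_measure M2"
    unfolding M1_def M2_def by (auto intro!: finite_measure_lebesgue_on)
  then interpret P: pair_sigma_finite M1 M2
    by (simp add: pair_sigma_finite_def finite_measure_def)
  have p_meas [measurable]: "p \<in> borel_measurable M1"
    using p unfolding M1_def by (intro borel_measurable_integrable) (simp add: conv)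
  have id_meas [measurable]: "(\<lambda>k. k) \<in> borel_measurable M2"
    unfolding M2_def by (intro continuous_imp_measurable_on_sets_lebesgue continuous_intros) auto
  have w_int: "integrable M1 w"
    unfolding M1_def conv w_def using p ep
    by (intro set_integrable_mult_right set_integral_add absolutely_integrable_max_1)
      (auto intro: absolutely_integrable_continuous_real)
  have wP: "integrable (M1 \<Otimes>\<^sub>M M2) (\<lambda>(x, k). w x)"
  proof (rule P.Fubini_integrable)
    show "(\<lambda>(x, k). w x) \<in> borel_measurable (M1 \<Otimes>\<^sub>M M2)"
      unfolding w_def by measurable
    show "integrable M1 (\<lambda>x. LINT k|M2. norm (case (x, k) of (x, k) \<Rightarrow> w x))"
      using w_int by simp
    show "AE x in M1. integrable M2 (\<lambda>k. case (x, k) of (x, k) \<Rightarrow> w x)"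
      using fin(2) by (simp add: finite_measure.integrable_const)
  qed
  have bound: "\<bar>f x k\<bar> \<le> w x" if "k \<in> {0..N}" for x k
  proof -
    define y where "y = max 0 (p x - k)"
    have y: "0 \<le> y" "1 \<le> exp y"
      by (simp_all add: y_def)
    define z where "z = (1 - \<xi>) * (exp y - 1)"
    have z: "z \<le> 1 * (exp y - 1)" "0 \<le> z"
      unfolding z_def using \<xi> y by (intro mult_right_mono mult_nonneg_nonneg; simp)+
    have "z - y \<le> exp y + y" "- (z - y) \<le> exp y + y"
      using y z by auto
    then have "\<bar>z - y\<bar> \<le> exp y + y"
      by (rule abs_leI)
    then have "\<bar>excess \<xi> (p x - k)\<bar> \<le> exp (max 0 (p x - k)) + max 0 (p x - k)"
      by (simp add: excess_def z_def y_def)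
    also have "\<dots> \<le> exp (max 0 (p x)) + max 0 (p x)"
      using that by (intro add_mono) auto
    also have "exp (max 0 (p x)) = max 1 (exp (p x))"
      by (simp add: max_def)
    finally have "\<bar>excess \<xi> (p x - k)\<bar> \<le> max 1 (exp (p x)) + max 0 (p x)" .
    moreover have "exp (\<delta> * k) \<le> exp (\<delta> * N)"
      using that \<open>0 \<le> \<delta>\<close> by (simp add: mult_left_mono)
    ultimately show ?thesis
      unfolding f_def w_def abs_mult by (intro mult_mono) auto
  qed
  have fP: "integrable (M1 \<Otimes>\<^sub>M M2) (\<lambda>(x, k). f x k)"
  proof (rule Bochner_Integration.integrable_bound[OF wP])
    show "(\<lambda>(x, k). f x k) \<in> borel_measurable (M1 \<Otimes>\<^sub>M M2)"
      unfolding f_def excess_def by measurable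
    have "norm (f x k) \<le> norm (w x)" if "k \<in> space M2" for x k
      using bound[of k x] that by (auto simp: M2_def space_restrict_space)
    then show "AE z in M1 \<Otimes>\<^sub>M M2. norm (case z of (x, k) \<Rightarrow> f x k) \<le> norm (case z of (x, k) \<Rightarrow> w x)"
      by (intro AE_I2) (auto simp: space_pair_measure)
  qed
  have inner: "(LINT k|M2. f x k) = H x" for x
    unfolding M2_def f_def H_def
    by (intro L absolutely_integrable_continuous_real continuous_intros)
  have outer: "(LINT x|M1. f x k) = exp (\<delta> * k) * integral {a..b} (\<lambda>x. excess \<xi> (p x - k))" for k
    using L[OF absolutely_integrable_excess[OF p ep]] unfolding M1_def f_def by simp
  have "integrable M1 H"
    using P.integrable_fst[OF fP] by (simp add: inner)
  then have H: "H absolutely_integrable_on {a..b}"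
    by (simp add: M1_def conv)
  then show "H integrable_on {a..b}"
    by (rule set_lebesgue_integral_eq_integral)
  have "integral {a..b} H = (LINT x|M1. LINT k|M2. f x k)"
    using L[OF H] by (simp add: inner M1_def)
  also have "\<dots> = (LINT k|M2. LINT x|M1. f x k)"
    using P.Fubini_integral[OF fP] by simp
  also have "\<dots> \<le> (LINT k|M2. 0)"
  proof (rule integral_mono)
    show "integrable M2 (\<lambda>k. LINT x|M1. f x k)"
      using P.integrable_snd[OF fP] .
    show "(LINT x|M1. f x k) \<le> 0" if "k \<in> space M2" for k
      using that nonpos[of k] unfolding outer
      by (intro mult_nonneg_nonpos) (auto simp: M2_def space_restrict_space)
  qed simp
  finally show "integral {a..b} H \<le> 0"
    by simp
qed

text \<open>Shift \<open>\<phi>\<close> to \<open>p\<close> with mean \<open>\<xi>\<close>, so that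
  levels \<open>k \<ge> 0\<close> of \<open>p\<close> are exactly the heights allowed in
  \<open>integral_excess_nonpos\<close>. Integrating \<open>truncated_exp_bound\<close> gives a
  bound uniform in the truncation, and monotone convergence removes it.\<close>

lemma integral_exp_scaled_le:
  fixes \<phi> :: "real \<Rightarrow> real"
  assumes "a < b" "0 \<le> \<xi>" "\<xi> < 1" and C: "exp (- \<xi>) = C * (1 - \<xi>)"
    and \<phi>: "\<phi> absolutely_integrable_on {a..b}"
    and e\<phi>: "(\<lambda>x. exp (\<phi> x)) absolutely_integrable_on {a..b}"
    and A: "\<And>c d. \<lbrakk>a \<le> c; c < d; d \<le> b\<rbrakk> \<Longrightarrow>
      integral {c..d} (\<lambda>x. exp (\<phi> x)) \<le> (d - c) * C * exp (integral {c..d} \<phi> / (d - c))"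
    and \<delta>: "1 < \<delta>" "\<delta> * \<xi> < 1"
  defines "\<mu> \<equiv> integral {a..b} \<phi> / (b - a)"
  shows "(\<lambda>x. exp (\<delta> * \<phi> x)) absolutely_integrable_on {a..b}"
    and "integral {a..b} (\<lambda>x. exp (\<delta> * \<phi> x)) \<le> (b - a) * exp (\<delta> * (\<mu> - \<xi>)) / (1 - \<delta> * \<xi>)"
proof -
  define p where "p x = \<phi> x - (\<mu> - \<xi>)" for x
  have const: "(\<lambda>x. c) absolutely_integrable_on {a..b}" for c :: real
    by (simp add: absolutely_integrable_continuous_real)
  have p: "p absolutely_integrable_on {a..b}"
    unfolding p_def using \<phi> const by (intro set_integral_diff)
  have ep_eq: "exp (p x) = exp (\<xi> - \<mu>) * exp (\<phi> x)" for x
    by (simp add: p_def algebra_simps flip: exp_add)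
  have ep: "(\<lambda>x. exp (p x)) absolutely_integrable_on {a..b}"
    unfolding ep_eq using e\<phi> by (rule set_integrable_mult_right)
  have ints: "\<phi> integrable_on {a..b}" "(\<lambda>x. exp (\<phi> x)) integrable_on {a..b}"
      "p integrable_on {a..b}" "(\<lambda>x. exp (p x)) integrable_on {a..b}"
    using \<phi> e\<phi> p ep set_lebesgue_integral_eq_integral(1) by blast+
  have \<mu>: "integral {a..b} \<phi> = \<mu> * (b - a)"
    using \<open>a < b\<close> by (simp add: \<mu>_def)
  have mean: "integral {a..b} p = \<xi> * (b - a)"
  proof (rule integral_unique)
    have "(p has_integral integral {a..b} \<phi> - (b - a) * (\<mu> - \<xi>)) {a..b}"
      unfolding p_def using has_integral_const_real[of "\<mu> - \<xi>" a b] ints(1) \<open>a < b\<close>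
      by (intro has_integral_diff integrable_integral) auto
    then show "(p has_integral \<xi> * (b - a)) {a..b}"
      by (simp add: \<mu> algebra_simps)
  qed
  \<comment> \<open>Hypothesis \<open>A\<close> on the whole interval, with
    \<open>C * (1 - \<xi>)\<close> rewritten as \<open>exp (- \<xi>)\<close>.\<close>
  have mass: "(1 - \<xi>) * integral {a..b} (\<lambda>x. exp (p x)) \<le> b - a"
  proof -
    have "(1 - \<xi>) * exp (\<xi> - \<mu>) * integral {a..b} (\<lambda>x. exp (\<phi> x))
      \<le> (1 - \<xi>) * exp (\<xi> - \<mu>) * ((b - a) * C * exp \<mu>)"
      using A[of a b] \<open>a < b\<close> \<open>\<xi> < 1\<close> by (intro mult_left_mono) (auto simp: \<mu>_def)
    also have "\<dots> = (b - a) * (C * (1 - \<xi>)) * exp \<xi>"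
      by (simp add: exp_diff)
    also have "\<dots> = b - a"
      unfolding C[symmetric] by (simp add: exp_minus)
    finally show ?thesis
      unfolding ep_eq by (simp add: mult.assoc)
  qed
  have trunc_int: "(\<lambda>x. exp (\<delta> * min (p x) (real n))) integrable_on {a..b}" for n
  proof (rule measurable_bounded_by_integrable_imp_integrable)
    have "p \<in> borel_measurable (lebesgue_on {a..b})"
      using ints(3) by (rule integrable_imp_measurable)
    then show "(\<lambda>x. exp (\<delta> * min (p x) (real n))) \<in> borel_measurable (lebesgue_on {a..b})"
      by measurable
    show "(\<lambda>x. exp (\<delta> * real n)) integrable_on {a..b}"
      by (intro integrable_continuous_real continuous_intros)
    show "norm (exp (\<delta> * min (p x) (real n))) \<le> exp (\<delta> * real n)" for x
      using \<delta>(1) by simp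
  qed auto
  have trunc_le: "(1 - \<delta> * \<xi>) * integral {a..b} (\<lambda>x. exp (\<delta> * min (p x) (real n))) \<le> b - a" for n
  proof -
    define H where "H x = integral {0..real n} (\<lambda>k. exp (\<delta> * k) * excess \<xi> (p x - k))" for x
    have "integral {a..b} (\<lambda>x. excess \<xi> (p x - k)) \<le> 0" if "k \<in> {0..real n}" for k
    proof -
      have "integral {a..b} \<phi> \<le> ((\<mu> - \<xi> + k) + \<xi>) * (b - a)"
        using that \<open>a < b\<close> unfolding \<mu> by (intro mult_right_mono) auto
      from integral_excess_nonpos[OF \<open>a < b\<close> \<open>0 \<le> \<xi>\<close> \<open>\<xi> < 1\<close> C \<phi> e\<phi> A this]
      show ?thesis
        by (simp add: p_def algebra_simps)
    qed
    then have H: "H integrable_on {a..b}" "integral {a..b} H \<le> 0"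
      unfolding H_def
      using integral_weighted_excess_nonpos[OF p ep \<open>0 \<le> \<xi>\<close> \<open>\<xi> < 1\<close>, of \<delta> "real n"] \<delta> by auto
    have "((\<lambda>x. (1 - \<xi>) * \<delta>\<^sup>2 * exp (p x) - (\<delta> - 1) * (\<delta> * (1 - \<xi>) + 1) - \<delta> * (\<delta> - 1) * p x
          + \<delta>\<^sup>2 * (\<delta> - 1) * H x) has_integral
        (1 - \<xi>) * \<delta>\<^sup>2 * integral {a..b} (\<lambda>x. exp (p x))
          - (b - a) * ((\<delta> - 1) * (\<delta> * (1 - \<xi>) + 1)) - \<delta> * (\<delta> - 1) * integral {a..b} p
          + \<delta>\<^sup>2 * (\<delta> - 1) * integral {a..b} H) {a..b}"
      using ints(3,4) H(1) \<open>a < b\<close>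
        has_integral_const_real[of "(\<delta> - 1) * (\<delta> * (1 - \<xi>) + 1)" a b]
      by (intro has_integral_add has_integral_diff has_integral_mult_right integrable_integral) auto
    then have "integral {a..b} (\<lambda>x. (1 - \<delta> * \<xi>) * exp (\<delta> * min (p x) (real n)))
      \<le> (1 - \<xi>) * \<delta>\<^sup>2 * integral {a..b} (\<lambda>x. exp (p x))
          - (b - a) * ((\<delta> - 1) * (\<delta> * (1 - \<xi>) + 1)) - \<delta> * (\<delta> - 1) * integral {a..b} p
          + \<delta>\<^sup>2 * (\<delta> - 1) * integral {a..b} H"
      using trunc_int[of n] truncated_exp_bound[OF \<delta>(1) \<open>0 \<le> \<xi>\<close> \<delta>(2), of "real n"]
      by (intro has_integral_le[OF integrable_integral]) (auto simp: H_def intro: integrable_on_mult_right)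
    also have "\<dots> \<le> \<delta>\<^sup>2 * (b - a) - (b - a) * ((\<delta> - 1) * (\<delta> * (1 - \<xi>) + 1))
        - \<delta> * (\<delta> - 1) * (\<xi> * (b - a))"
    proof -
      have "\<delta>\<^sup>2 * ((1 - \<xi>) * integral {a..b} (\<lambda>x. exp (p x))) \<le> \<delta>\<^sup>2 * (b - a)"
        using mass by (intro mult_left_mono) auto
      moreover have "\<delta>\<^sup>2 * (\<delta> - 1) * integral {a..b} H \<le> 0"
        using \<delta> H(2) by (intro mult_nonneg_nonpos) auto
      ultimately show ?thesis
        unfolding mean by (simp add: mult.commute mult.left_commute)
    qed
    \<comment> \<open>The terms in \<open>\<xi>\<close> cancel, and
      \<open>\<delta>\<^sup>2 - (\<delta> - 1) * (\<delta> + 1) = 1\<close>.\<close>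
    also have "\<dots> = b - a"
      by (simp add: algebra_simps power2_eq_square)
    finally show ?thesis by simp
  qed
  have pos: "0 < 1 - \<delta> * \<xi>"
    using \<delta>(2) by simp
  \<comment> \<open>The uniform bound \<open>trunc_le\<close> yields integrability of the limit
    together with convergence of the integrals.\<close>
  have lim: "(\<lambda>x. exp (\<delta> * p x)) integrable_on {a..b} \<and>
    (\<lambda>n. integral {a..b} (\<lambda>x. exp (\<delta> * min (p x) (real n)))) \<longlonglongrightarrow> integral {a..b} (\<lambda>x. exp (\<delta> * p x))"
  proof (rule monotone_convergence_increasing)
    show "(\<lambda>x. exp (\<delta> * min (p x) (real n))) integrable_on {a..b}" for n
      by (rule trunc_int)
    show "exp (\<delta> * min (p x) (real n)) \<le> exp (\<delta> * min (p x) (real (Suc n)))" for n x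
      using \<delta>(1) by (auto intro!: mult_left_mono)
    show "(\<lambda>n. exp (\<delta> * min (p x) (real n))) \<longlonglongrightarrow> exp (\<delta> * p x)" for x
    proof (rule tendsto_eventually)
      obtain n0 :: nat where "p x \<le> real n0"
        using real_arch_simple by blast
      then show "\<forall>\<^sub>F n in sequentially. exp (\<delta> * min (p x) (real n)) = exp (\<delta> * p x)"
        by (intro eventually_sequentiallyI[of n0]) auto
    qed
    have "\<bar>integral {a..b} (\<lambda>x. exp (\<delta> * min (p x) (real n)))\<bar> \<le> (b - a) / (1 - \<delta> * \<xi>)" for n
    proof -
      have "0 \<le> integral {a..b} (\<lambda>x. exp (\<delta> * min (p x) (real n)))"
        by (intro Henstock_Kurzweil_Integration.integral_nonneg trunc_int) auto
      then show ?thesis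
        using trunc_le[of n] pos by (simp add: field_simps)
    qed
    then show "bounded (range (\<lambda>n. integral {a..b} (\<lambda>x. exp (\<delta> * min (p x) (real n)))))"
      by (auto simp: bounded_iff)
  qed
  have "integral {a..b} (\<lambda>x. exp (\<delta> * p x)) \<le> (b - a) / (1 - \<delta> * \<xi>)"
    using trunc_le pos by (intro LIMSEQ_le_const2[OF conjunct2[OF lim]]) (auto simp: field_simps)
  then have le: "exp (\<delta> * (\<mu> - \<xi>)) * integral {a..b} (\<lambda>x. exp (\<delta> * p x))
    \<le> exp (\<delta> * (\<mu> - \<xi>)) * ((b - a) / (1 - \<delta> * \<xi>))"
    by (intro mult_left_mono) auto
  have eq: "exp (\<delta> * \<phi> x) = exp (\<delta> * (\<mu> - \<xi>)) * exp (\<delta> * p x)" for x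
    by (simp add: p_def algebra_simps flip: exp_add)
  show "(\<lambda>x. exp (\<delta> * \<phi> x)) absolutely_integrable_on {a..b}"
    unfolding eq using lim
    by (intro nonnegative_absolutely_integrable_1 integrable_on_mult_right) auto
  show "integral {a..b} (\<lambda>x. exp (\<delta> * \<phi> x)) \<le> (b - a) * exp (\<delta> * (\<mu> - \<xi>)) / (1 - \<delta> * \<xi>)"
    unfolding eq using le by (simp add: mult.commute)
qed

section \<open>Averages and the A_infinity condition on closed intervals\<close>

lemma negligible_interval_diff:
  fixes J :: "real set"
  assumes "{a<..<b} \<subseteq> J" "J \<subseteq> {a..b}"
  shows "negligible ({a..b} - J)" "negligible (J - {a..b})"
proof -
  have "{a..b} - J \<subseteq> {a, b}"
    using assms(1) by force
  then show "negligible ({a..b} - J)"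
    by (rule negligible_subset[rotated]) (simp add: negligible_finite)
  show "negligible (J - {a..b})"
    using assms(2) by (simp add: Diff_eq_empty_iff[THEN iffD2])
qed

lemma absolutely_integrable_on_interval_iff:
  fixes f :: "real \<Rightarrow> real"
  assumes "{a<..<b} \<subseteq> J" "J \<subseteq> {a..b}"
  shows "f absolutely_integrable_on J \<longleftrightarrow> f absolutely_integrable_on {a..b}"
  by (rule absolutely_integrable_spike_set_eq)
    (auto intro: negligible_subset[OF negligible_interval_diff(1)[OF assms]]
      negligible_subset[OF negligible_interval_diff(2)[OF assms]])

lemma avg_interval:
  fixes f :: "real \<Rightarrow> real"
  assumes "a < b" and J: "{a<..<b} \<subseteq> J" "J \<subseteq> {a..b}"
    and f: "f absolutely_integrable_on {a..b}"
  shows "avg J f = integral {a..b} f / (b - a)"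
proof -
  note neg = negligible_interval_diff[OF J]
  have "(LINT x:J|lebesgue. f x) = integral J f"
    using f absolutely_integrable_on_interval_iff[OF J] set_lebesgue_integral_eq_integral(2) by blast
  also have "\<dots> = integral {a..b} f"
    by (rule integral_spike_set)
      (auto intro: negligible_subset[OF neg(1)] negligible_subset[OF neg(2)])
  finally have "(LINT x:J|lebesgue. f x) = integral {a..b} f" .
  moreover have "measure lebesgue J = measure lebesgue {a..b}"
    using neg by (intro measure_negligible_symdiff) (auto intro: negligible_Un)
  ultimately show ?thesis
    using \<open>a < b\<close> by (simp add: avg_def)
qed

lemma subinterval_endpoints:
  assumes "J \<in> subintervals Q"
  obtains a b where "a < b" "{a<..<b} \<subseteq> J" "J \<subseteq> {a..b}" "J \<subseteq> Q"
  using assms bounded_interval_endpoints[of J]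
  unfolding subintervals_def proper_interval_def by auto

lemma open_interval_subinterval:
  "a < b \<Longrightarrow> {a<..<b} \<subseteq> Q \<Longrightarrow> {a<..<b} \<in> subintervals Q"
  by (simp add: subintervals_def proper_interval_def interior_open is_interval_oo)

text \<open>Endpoints do not affect integrals, so only the open interval has to lie in
  \<open>Q\<close>; \<open>{c..d}\<close> may stick out, for instance when \<open>Q\<close> is
  open.\<close>

lemma exp_in_Ainf_leD:
  assumes w: "(\<lambda>x. exp (\<phi> x)) \<in> Ainf_le C Q" and "c < d" "{c<..<d} \<subseteq> Q"
  shows "\<phi> absolutely_integrable_on {c..d}" "(\<lambda>x. exp (\<phi> x)) absolutely_integrable_on {c..d}"
    "integral {c..d} (\<lambda>x. exp (\<phi> x)) \<le> (d - c) * C * exp (integral {c..d} \<phi> / (d - c))"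
proof -
  let ?J = "{c<..<d}"
  have J: "?J \<in> subintervals Q" and sub: "?J \<subseteq> ?J" "?J \<subseteq> {c..d}"
    using assms open_interval_subinterval by auto
  show \<phi>: "\<phi> absolutely_integrable_on {c..d}"
    and e\<phi>: "(\<lambda>x. exp (\<phi> x)) absolutely_integrable_on {c..d}"
    using w J absolutely_integrable_on_interval_iff[OF sub]
    by (auto simp: Ainf_le_def Ainf_def locally_integrable_def)
  have "ereal (avg ?J (\<lambda>x. exp (\<phi> x)) * exp (- avg ?J \<phi>)) \<le> Ainf_const Q (\<lambda>x. exp (\<phi> x))"
    unfolding Ainf_const_def by (rule SUP_upper2[OF J]) simp
  also have "\<dots> \<le> ereal C"
    using w by (simp add: Ainf_le_def)
  finally have "integral {c..d} (\<lambda>x. exp (\<phi> x)) / (d - c) * exp (- (integral {c..d} \<phi> / (d - c))) \<le> C"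
    using avg_interval[OF \<open>c < d\<close> sub \<phi>] avg_interval[OF \<open>c < d\<close> sub e\<phi>] by simp
  then show "integral {c..d} (\<lambda>x. exp (\<phi> x)) \<le> (d - c) * C * exp (integral {c..d} \<phi> / (d - c))"
    using \<open>c < d\<close> by (simp add: exp_minus field_simps)
qed

text \<open>Every member of \<open>subintervals Q\<close> lies between an open interval and its
  closure, with the same integrals.\<close>

lemma exp_in_Ainf_leI:
  assumes bound: "\<And>a b. \<lbrakk>a < b; {a<..<b} \<subseteq> Q\<rbrakk> \<Longrightarrow>
      \<psi> absolutely_integrable_on {a..b} \<and> (\<lambda>x. exp (\<psi> x)) absolutely_integrable_on {a..b} \<and>
      integral {a..b} (\<lambda>x. exp (\<psi> x)) / (b - a) * exp (- (integral {a..b} \<psi> / (b - a))) \<le> K"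
  shows "(\<lambda>x. exp (\<psi> x)) \<in> Ainf_le K Q"
proof -
  have J: "\<psi> absolutely_integrable_on J" "(\<lambda>x. exp (\<psi> x)) absolutely_integrable_on J"
    "avg J (\<lambda>x. exp (\<psi> x)) * exp (- avg J \<psi>) \<le> K" if "J \<in> subintervals Q" for J
  proof -
    from that obtain a b where ab: "a < b" and sub: "{a<..<b} \<subseteq> J" "J \<subseteq> {a..b}" and "J \<subseteq> Q"
      by (rule subinterval_endpoints)
    then have *: "\<psi> absolutely_integrable_on {a..b} \<and> (\<lambda>x. exp (\<psi> x)) absolutely_integrable_on {a..b} \<and>
      integral {a..b} (\<lambda>x. exp (\<psi> x)) / (b - a) * exp (- (integral {a..b} \<psi> / (b - a))) \<le> K"
      by (intro bound) auto
    then show "\<psi> absolutely_integrable_on J" "(\<lambda>x. exp (\<psi> x)) absolutely_integrable_on J"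
      using absolutely_integrable_on_interval_iff[OF sub] by auto
    show "avg J (\<lambda>x. exp (\<psi> x)) * exp (- avg J \<psi>) \<le> K"
      using * avg_interval[OF ab sub] by simp
  qed
  have "Ainf_const Q (\<lambda>x. exp (\<psi> x)) \<le> ereal K"
    unfolding Ainf_const_def using J(3) by (intro SUP_least) simp
  then show ?thesis
    using J by (auto simp: Ainf_le_def Ainf_def locally_integrable_def)
qed

lemma exp_scaled_in_Ainf_le:
  assumes "1 \<le> C" "1 \<le> \<delta>" "\<delta> * xi_plus C < 1"
    and w: "(\<lambda>x. exp (\<phi> x)) \<in> Ainf_le C Q"
  shows "(\<lambda>x. exp (\<delta> * \<phi> x)) \<in> Ainf_le (exp (- (\<delta> * xi_plus C)) / (1 - \<delta> * xi_plus C)) Q"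
proof (cases "\<delta> = 1")
  \<comment> \<open>For \<open>\<delta> = 1\<close> the bound is \<open>C\<close> itself by the
    equation for \<open>xi_plus\<close>; the weighted argument divides by
    \<open>\<delta> - 1\<close>.\<close>
  case True
  then show ?thesis
    using w xi_plus[OF \<open>1 \<le> C\<close>] by simp
next
  case False
  let ?\<xi> = "xi_plus C"
  show ?thesis
  proof (rule exp_in_Ainf_leI)
    fix a b :: real
    assume ab: "a < b" "{a<..<b} \<subseteq> Q"
    note \<phi> = exp_in_Ainf_leD[OF w ab]
    have A: "integral {c..d} (\<lambda>x. exp (\<phi> x)) \<le> (d - c) * C * exp (integral {c..d} \<phi> / (d - c))"
      if "a \<le> c" "c < d" "d \<le> b" for c d
    proof (rule exp_in_Ainf_leD(3)[OF w \<open>c < d\<close>])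
      show "{c<..<d} \<subseteq> Q"
        using that ab(2) by (auto intro!: subsetD[OF ab(2)])
    qed
    have "1 < \<delta>"
      using False \<open>1 \<le> \<delta>\<close> by simp
    note le = integral_exp_scaled_le[OF ab(1) xi_plus[OF \<open>1 \<le> C\<close>] \<phi>(1,2) A this \<open>\<delta> * ?\<xi> < 1\<close>]
    define \<mu> where "\<mu> = integral {a..b} \<phi> / (b - a)"
    have "integral {a..b} (\<lambda>x. exp (\<delta> * \<phi> x)) / (b - a) \<le> exp (\<delta> * (\<mu> - ?\<xi>)) / (1 - \<delta> * ?\<xi>)"
      using le(2) ab(1) by (simp add: \<mu>_def field_simps)
    then have "integral {a..b} (\<lambda>x. exp (\<delta> * \<phi> x)) / (b - a) * exp (- (\<delta> * \<mu>))
      \<le> exp (\<delta> * (\<mu> - ?\<xi>)) / (1 - \<delta> * ?\<xi>) * exp (- (\<delta> * \<mu>))"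
      by (intro mult_right_mono) auto
    also have "\<dots> = exp (- (\<delta> * ?\<xi>)) / (1 - \<delta> * ?\<xi>)"
      by (simp add: algebra_simps flip: exp_add)
    finally show "(\<lambda>x. \<delta> * \<phi> x) absolutely_integrable_on {a..b} \<and>
      (\<lambda>x. exp (\<delta> * \<phi> x)) absolutely_integrable_on {a..b} \<and>
      integral {a..b} (\<lambda>x. exp (\<delta> * \<phi> x)) / (b - a) * exp (- (integral {a..b} (\<lambda>x. \<delta> * \<phi> x) / (b - a)))
        \<le> exp (- (\<delta> * ?\<xi>)) / (1 - \<delta> * ?\<xi>)"
      using \<phi>(1) le(1) by (simp add: \<mu>_def)
  qed
qed

section \<open>The extremal power weights\<close>

text \<open>Inverting the variable reduces the limit at 0 to \<open>ln y / y\<close> tending to 0 at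
  infinity. This makes the antiderivative of \<open>ln\<close> continuous up to the
  singularity.\<close>

lemma continuous_on_mult_ln: "continuous_on {0..} (\<lambda>x::real. x * ln x)"
proof -
  have "((\<lambda>x::real. x * ln x) \<longlongrightarrow> 0 * ln 0) (at_right 0)"
  proof -
    have "((\<lambda>x::real. - (ln (inverse x) / inverse x)) \<longlongrightarrow> - 0) (at_right 0)"
      by (intro tendsto_minus filterlim_compose[OF ln_x_over_x_tendsto_0 filterlim_inverse_at_top_right])
    then have "((\<lambda>x::real. - (ln (inverse x) / inverse x)) \<longlongrightarrow> 0 * ln 0) (at_right 0)"
      by simp
    then show ?thesis
      by (rule Lim_transform_eventually)
        (auto simp: ln_inverse divide_inverse
          intro!: eventually_mono[OF eventually_at_right_less[of 0]])
  qed
  then have "((\<lambda>x::real. x * ln x) \<longlongrightarrow> x * ln x) (at x within {0..})" if "x \<ge> 0" for x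
    using that
    by (cases "x = 0") (auto simp: at_within_Ici_at_right intro!: tendsto_intros)
  then show ?thesis
    by (auto simp: continuous_on_def)
qed

lemma integral_ln_shifted:
  fixes l c d :: real
  assumes "l \<le> c" "c < d"
  shows "(\<lambda>x. ln (x - l)) absolutely_integrable_on {c..d}"
    and "integral {c..d} (\<lambda>x. ln (x - l)) = (d - l) * ln (d - l) - (c - l) * ln (c - l) - (d - c)"
proof -
  have "((\<lambda>x. ln (x - l)) has_integral
      ((d - l) * ln (d - l) - d) - ((c - l) * ln (c - l) - c)) {c..d}"
  proof (rule fundamental_theorem_of_calculus_interior)
    show "continuous_on {c..d} (\<lambda>x. (x - l) * ln (x - l) - x)"
      using assms
      by (intro continuous_on_diff continuous_on_compose2[OF continuous_on_mult_ln, of _ "\<lambda>x. x - l"]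
          continuous_intros) auto
    fix x assume "x \<in> {c<..<d}"
    then have "((\<lambda>x. (x - l) * ln (x - l) - x) has_real_derivative ln (x - l)) (at x)"
      using assms by (auto intro!: derivative_eq_intros)
    then show "((\<lambda>x. (x - l) * ln (x - l) - x) has_vector_derivative ln (x - l)) (at x)"
      by (simp add: has_real_derivative_iff_has_vector_derivative)
  qed (use assms in auto)
  then have int: "((\<lambda>x. ln (x - l)) has_integral
      (d - l) * ln (d - l) - (c - l) * ln (c - l) - (d - c)) {c..d}"
    by (simp add: algebra_simps)
  then show "integral {c..d} (\<lambda>x. ln (x - l)) = (d - l) * ln (d - l) - (c - l) * ln (c - l) - (d - c)"
    by (rule integral_unique)
  \<comment> \<open>Absolute integrability follows from integrability of the nonnegative
    \<open>K - ln (x - l)\<close>; the maximum with 0 covers the value \<open>ln 0 = 0\<close> at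
    \<open>x = l\<close>.\<close>
  define K where "K = max 0 (ln (d - l))"
  have le_K: "ln (x - l) \<le> K" if "x \<in> {c..d}" for x
  proof (cases "x = l")
    case False
    then have "ln (x - l) \<le> ln (d - l)"
      using that assms by simp
    then show ?thesis by (simp add: K_def)
  qed (simp add: K_def)
  have const: "(\<lambda>x. K) absolutely_integrable_on {c..d}"
    by (simp add: absolutely_integrable_continuous_real)
  have "(\<lambda>x. K - ln (x - l)) integrable_on {c..d}"
    using int by (intro integrable_diff) auto
  then have "(\<lambda>x. K - ln (x - l)) absolutely_integrable_on {c..d}"
    by (rule nonnegative_absolutely_integrable_1) (use le_K in auto)
  from set_integral_diff(1)[OF const this]
  show "(\<lambda>x. ln (x - l)) absolutely_integrable_on {c..d}"
    by simp
qed

lemma integral_power_weight: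
  fixes l c d \<eta> :: real
  assumes "l \<le> c" "c < d" "\<eta> < 1"
  shows "(\<lambda>x. exp (- (\<eta> * ln (x - l)))) absolutely_integrable_on {c..d}"
    and "integral {c..d} (\<lambda>x. exp (- (\<eta> * ln (x - l))))
      = ((d - l) powr (1 - \<eta>) - (c - l) powr (1 - \<eta>)) / (1 - \<eta>)"
proof -
  have "((\<lambda>x. exp (- (\<eta> * ln (x - l)))) has_integral
      (d - l) powr (1 - \<eta>) / (1 - \<eta>) - (c - l) powr (1 - \<eta>) / (1 - \<eta>)) {c..d}"
  proof (rule fundamental_theorem_of_calculus_interior)
    show "continuous_on {c..d} (\<lambda>x. (x - l) powr (1 - \<eta>) / (1 - \<eta>))"
      using assms by (intro continuous_on_divide continuous_on_powr' continuous_intros) auto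
    fix x assume x: "x \<in> {c<..<d}"
    then have "((\<lambda>x. (x - l) powr (1 - \<eta>) / (1 - \<eta>)) has_real_derivative
        (1 - \<eta>) * (x - l) powr (1 - \<eta> - 1) / (1 - \<eta>)) (at x)"
      using assms by (intro DERIV_cdivide DERIV_fun_powr[where g = "\<lambda>x. x - l" and m = 1, simplified])
        (auto intro!: derivative_eq_intros)
    moreover have "(1 - \<eta>) * (x - l) powr (1 - \<eta> - 1) / (1 - \<eta>) = exp (- (\<eta> * ln (x - l)))"
      using x assms by (simp add: powr_def)
    ultimately show "((\<lambda>x. (x - l) powr (1 - \<eta>) / (1 - \<eta>)) has_vector_derivative
        exp (- (\<eta> * ln (x - l)))) (at x)"
      by (simp add: has_real_derivative_iff_has_vector_derivative)
  qed (use assms in auto)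
  then have int: "((\<lambda>x. exp (- (\<eta> * ln (x - l)))) has_integral
      ((d - l) powr (1 - \<eta>) - (c - l) powr (1 - \<eta>)) / (1 - \<eta>)) {c..d}"
    by (simp add: diff_divide_distrib)
  then show "integral {c..d} (\<lambda>x. exp (- (\<eta> * ln (x - l))))
      = ((d - l) powr (1 - \<eta>) - (c - l) powr (1 - \<eta>)) / (1 - \<eta>)"
    by (rule integral_unique)
  show "(\<lambda>x. exp (- (\<eta> * ln (x - l)))) absolutely_integrable_on {c..d}"
    using int by (intro nonnegative_absolutely_integrable_1) auto
qed

lemma powr_one_minus:
  fixes y \<xi> :: real
  assumes "0 \<le> y"
  shows "y powr (1 - \<xi>) = y * exp (- (\<xi> * ln y))"
proof (cases "y = 0")
  case False
  then have "y powr (1 - \<xi>) = exp (ln y + - (\<xi> * ln y))"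
    by (simp add: powr_def algebra_simps)
  then show ?thesis
    unfolding exp_add using assms False by simp
qed simp

text \<open>Jensen's inequality for \<open>exp\<close> with weights \<open>u / v\<close> and \<open>1 - u / v\<close>: the exponents
  \<open>- \<xi> ln u\<close> and \<open>- \<xi> M\<close> have mean \<open>- \<xi> ln v\<close>.\<close>

lemma powr_difference_quotient_le:
  fixes u v \<xi> :: real
  assumes "0 \<le> u" "u < v"
  shows "(v powr (1 - \<xi>) - u powr (1 - \<xi>)) / (v - u)
    \<le> exp (- (\<xi> * ((v * ln v - u * ln u) / (v - u))))"
proof -
  define M where "M = (v * ln v - u * ln u) / (v - u)"
  have M: "(v - u) * M = v * ln v - u * ln u"
    using assms by (simp add: M_def)
  define t where "t = u / v"
  have tv: "v * t = u" "v * (1 - t) = v - u" and t: "0 \<le> t" "t \<le> 1"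
    using assms by (auto simp: t_def algebra_simps)
  have "v * (t * (- (\<xi> * ln u)) + (1 - t) * (- (\<xi> * M))) = - (\<xi> * (u * ln u + (v - u) * M))"
    unfolding tv[symmetric] by (simp add: algebra_simps)
  also have "\<dots> = v * (- (\<xi> * ln v))"
    unfolding M by (simp add: algebra_simps)
  finally have "t * (- (\<xi> * ln u)) + (1 - t) * (- (\<xi> * M)) = - (\<xi> * ln v)"
    using assms by (subst (asm) mult_left_cancel) auto
  then have "exp (- (\<xi> * ln v)) \<le> t * exp (- (\<xi> * ln u)) + (1 - t) * exp (- (\<xi> * M))"
    using exp_convex_combination[OF t] by metis
  then have "v * exp (- (\<xi> * ln v)) \<le> v * (t * exp (- (\<xi> * ln u)) + (1 - t) * exp (- (\<xi> * M)))"
    using assms by (intro mult_left_mono) auto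
  also have "\<dots> = (v * t) * exp (- (\<xi> * ln u)) + (v * (1 - t)) * exp (- (\<xi> * M))"
    by (simp add: algebra_simps)
  finally have "v powr (1 - \<xi>) - u powr (1 - \<xi>) \<le> (v - u) * exp (- (\<xi> * M))"
    unfolding tv using assms by (simp add: powr_one_minus)
  then show ?thesis
    using assms by (simp add: M_def field_simps)
qed

text \<open>With \<open>M\<close> as in the proof, the mean of \<open>ln (x - l)\<close> is
  \<open>M - 1\<close> and the mean of the weight is at most
  \<open>exp (- (\<xi> * M)) / (1 - \<xi>)\<close>; \<open>M\<close> cancels in the product.\<close>

lemma power_weight_in_Ainf_le:
  assumes "\<xi> < 1" "Q \<subseteq> {l..}"
  shows "(\<lambda>x. exp (- (\<xi> * ln (x - l)))) \<in> Ainf_le (exp (- \<xi>) / (1 - \<xi>)) Q"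
proof (rule exp_in_Ainf_leI)
  fix a b :: real
  assume ab: "a < b" "{a<..<b} \<subseteq> Q"
  then have "{a<..<b} \<subseteq> {l..}"
    using assms(2) by blast
  \<comment> \<open>Only the open interval is known to lie in \<open>Q\<close>; taking closures
    gives \<open>l \<le> a\<close>.\<close>
  then have "closure {a<..<b} \<subseteq> {l..}"
    by (rule closure_minimal) simp
  then have la: "l \<le> a"
    using ab(1) by simp
  note ln = integral_ln_shifted[OF la ab(1)] and pw = integral_power_weight[OF la ab(1) \<open>\<xi> < 1\<close>]
  define u v where "u = a - l" and "v = b - l"
  define M where "M = (v * ln v - u * ln u) / (v - u)"
  have uv: "0 \<le> u" "u < v" "b - a = v - u"
    using la ab(1) by (auto simp: u_def v_def)
  have "integral {a..b} (\<lambda>x. ln (x - l)) = (v * ln v - u * ln u) - (v - u)"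
    unfolding u_def v_def by (simp add: ln(2))
  then have "integral {a..b} (\<lambda>x. ln (x - l)) / (b - a) = M - 1"
    using uv unfolding M_def by (simp add: diff_divide_distrib)
  moreover have "integral {a..b} (\<lambda>x. - (\<xi> * ln (x - l))) / (b - a)
      = - (\<xi> * (integral {a..b} (\<lambda>x. ln (x - l)) / (b - a)))"
    by simp
  ultimately have mean: "integral {a..b} (\<lambda>x. - (\<xi> * ln (x - l))) / (b - a) = - (\<xi> * (M - 1))"
    by simp
  have "integral {a..b} (\<lambda>x. exp (- (\<xi> * ln (x - l)))) / (b - a)
      = (v powr (1 - \<xi>) - u powr (1 - \<xi>)) / (v - u) / (1 - \<xi>)"
    using pw(2) uv(3) by (simp add: u_def v_def)
  also have "\<dots> \<le> exp (- (\<xi> * M)) / (1 - \<xi>)"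
    using powr_difference_quotient_le[OF uv(1,2), of \<xi>] \<open>\<xi> < 1\<close>
    by (intro divide_right_mono) (auto simp: M_def)
  finally have "integral {a..b} (\<lambda>x. exp (- (\<xi> * ln (x - l)))) / (b - a) * exp (\<xi> * (M - 1))
      \<le> exp (- (\<xi> * M)) / (1 - \<xi>) * exp (\<xi> * (M - 1))"
    by (intro mult_right_mono) auto
  also have "\<dots> = exp (- \<xi>) / (1 - \<xi>)"
    by (simp add: algebra_simps flip: exp_add)
  finally show "(\<lambda>x. - (\<xi> * ln (x - l))) absolutely_integrable_on {a..b} \<and>
      (\<lambda>x. exp (- (\<xi> * ln (x - l)))) absolutely_integrable_on {a..b} \<and>
      integral {a..b} (\<lambda>x. exp (- (\<xi> * ln (x - l)))) / (b - a)
        * exp (- (integral {a..b} (\<lambda>x. - (\<xi> * ln (x - l))) / (b - a)))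
      \<le> exp (- \<xi>) / (1 - \<xi>)"
    unfolding mean using pw(1) set_integrable_mult_right[OF ln(1), of "- \<xi>"] by simp
qed

text \<open>The interval \<open>Q\<close> itself, with the singularity at its left endpoint, is the
  extremal test interval.\<close>

lemma Ainf_const_power_weight_ge:
  assumes "\<eta> < 1" "proper_interval Q" "bounded Q"
    and ab: "a < b" "{a<..<b} \<subseteq> Q" "Q \<subseteq> {a..b}"
  shows "ereal (exp (- \<eta>) / (1 - \<eta>)) \<le> Ainf_const Q (\<lambda>x. exp (- (\<eta> * ln (x - a))))"
proof -
  have Q: "Q \<in> subintervals Q"
    using assms by (simp add: subintervals_def)
  note ln = integral_ln_shifted[OF order_refl ab(1)]
    and pw = integral_power_weight[OF order_refl ab(1) \<open>\<eta> < 1\<close>]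
  have "(\<lambda>x. - (\<eta> * ln (x - a))) absolutely_integrable_on {a..b}"
    using set_integrable_mult_right[OF ln(1), of "- \<eta>"] by simp
  moreover have "integral {a..b} (\<lambda>x. ln (x - a)) = (b - a) * (ln (b - a) - 1)"
    using ln(2) by (simp add: algebra_simps)
  ultimately have "avg Q (\<lambda>x. - (\<eta> * ln (x - a))) = - (\<eta> * (ln (b - a) - 1))"
    using avg_interval[OF ab] ab(1) by simp
  moreover have "avg Q (\<lambda>x. exp (- (\<eta> * ln (x - a)))) = exp (- (\<eta> * ln (b - a))) / (1 - \<eta>)"
    using avg_interval[OF ab pw(1)] pw(2) ab(1) by (simp add: powr_one_minus)
  ultimately have "avg Q (\<lambda>x. exp (- (\<eta> * ln (x - a)))) * exp (- avg Q (\<lambda>x. - (\<eta> * ln (x - a))))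
      = exp (- \<eta>) / (1 - \<eta>)"
    by (simp add: algebra_simps flip: exp_add)
  then show ?thesis
    unfolding Ainf_const_def by (intro SUP_upper2[OF Q]) simp
qed

theorem theorem1p11:
  fixes C \<delta> :: real
  assumes "1 \<le> C"
    and "1 \<le> \<delta>" and "ereal \<delta> < 1 / ereal (xi_plus C)"
  shows "(\<forall>Q \<phi>. proper_interval Q \<longrightarrow> (\<lambda>x. exp (\<phi> x)) \<in> Ainf_le C Q \<longrightarrow>
      (\<lambda>x. exp (\<delta> * \<phi> x)) \<in> Ainf Q \<and>
      Ainf_const Q (\<lambda>x. exp (\<delta> * \<phi> x))
        \<le> ereal (exp (- (\<delta> * xi_plus C)) / (1 - \<delta> * xi_plus C))) \<and>
    (\<forall>Q. proper_interval Q \<longrightarrow> bounded Q \<longrightarrow>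
      \<not> (\<exists>K::real. K < exp (- (\<delta> * xi_plus C)) / (1 - \<delta> * xi_plus C) \<and>
          (\<forall>\<phi>. (\<lambda>x. exp (\<phi> x)) \<in> Ainf_le C Q \<longrightarrow>
            Ainf_const Q (\<lambda>x. exp (\<delta> * \<phi> x)) \<le> ereal K)))"
proof -
  let ?\<xi> = "xi_plus C" and ?B = "exp (- (\<delta> * xi_plus C)) / (1 - \<delta> * xi_plus C)"
  note \<xi> = xi_plus[OF \<open>1 \<le> C\<close>]
  \<comment> \<open>For \<open>?\<xi> = 0\<close> the quotient \<open>1 / ereal 0\<close> is
    infinite and the claim is \<open>0 < 1\<close>; otherwise the bound on \<open>\<delta>\<close>
    is multiplied by \<open>?\<xi>\<close>.\<close>
  have \<delta>\<xi>: "\<delta> * ?\<xi> < 1"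
  proof (cases "?\<xi> = 0")
    case False
    then show ?thesis
      using assms(3) \<xi>(1) by (simp add: one_ereal_def field_simps)
  qed simp
  have "\<exists>\<phi>. (\<lambda>x. exp (\<phi> x)) \<in> Ainf_le C Q \<and> ereal ?B \<le> Ainf_const Q (\<lambda>x. exp (\<delta> * \<phi> x))"
    if Q: "proper_interval Q" "bounded Q" for Q
  proof -
    obtain a b where ab: "a < b" "{a<..<b} \<subseteq> Q" "Q \<subseteq> {a..b}"
      using Q bounded_interval_endpoints unfolding proper_interval_def by metis
    have "Q \<subseteq> {a..}"
      using ab(3) by auto
    moreover have "exp (- ?\<xi>) / (1 - ?\<xi>) = C"
      using \<xi> by simp
    ultimately have "(\<lambda>x. exp (- (?\<xi> * ln (x - a)))) \<in> Ainf_le C Q"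
      using power_weight_in_Ainf_le[OF \<xi>(2)] by simp
    \<comment> \<open>Scaling the exponent by \<open>\<delta>\<close> gives the power weight with
      exponent \<open>\<delta> * ?\<xi> < 1\<close>, whose constant reaches
      \<open>?B\<close>.\<close>
    moreover have "ereal ?B \<le> Ainf_const Q (\<lambda>x. exp (\<delta> * (- (?\<xi> * ln (x - a)))))"
      using Ainf_const_power_weight_ge[OF \<delta>\<xi> Q ab] by (simp add: mult.assoc)
    ultimately show ?thesis
      by (intro exI[of _ "\<lambda>x. - (?\<xi> * ln (x - a))"]) simp
  qed
  then have "\<not> (\<exists>K::real. K < ?B \<and> (\<forall>\<phi>. (\<lambda>x. exp (\<phi> x)) \<in> Ainf_le C Q \<longrightarrow>
      Ainf_const Q (\<lambda>x. exp (\<delta> * \<phi> x)) \<le> ereal K))" if "proper_interval Q" "bounded Q" for Q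
    using that by (meson ereal_less_eq(3) not_less order_trans)
  moreover have "(\<lambda>x. exp (\<delta> * \<phi> x)) \<in> Ainf Q \<and> Ainf_const Q (\<lambda>x. exp (\<delta> * \<phi> x)) \<le> ereal ?B"
    if "proper_interval Q" "(\<lambda>x. exp (\<phi> x)) \<in> Ainf_le C Q" for Q \<phi>
    using exp_scaled_in_Ainf_le[OF assms(1,2) \<delta>\<xi> that(2)] by (simp add: Ainf_le_def)
  ultimately show ?thesis
    by blast
qed

end
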